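(* Let $p\in[1,\infty]$, let $\omega$ be a fast majorant, and let $f=u+iv\in\mathscr{A}(\mathbb{D})$, where $u$ and $v$ are real-valued functions in $\mathbb{D}$ that are continuous up to $\mathbb{T}$. Let $q$ be a real number with $0<q\le p$ if $p<\infty$ and $0<q<\infty$ if $p=\infty$. Then the following statements are equivalent. (B1) There is a constant $M>0$ such that for all $z\in\mathbb{D}$: $\left(\int_0^{2\pi}|f'(ze^{i\eta})|^p\,d\eta\right)^{1/p}\le M\,\frac{\omega(d_{\mathbb{D}}(z))}{d_{\mathbb{D}}(z)}$ if $p\in[1,\infty)$, and $|f'(z)|\le M\,\frac{\omega(d_{\mathbb{D}}(z))}{d_{\mathbb{D}}(z)}$ if $p=\infty$. (B2) $f\in\Lambda_{\omega,p}(\overline{\mathbb{D}})$. (B3) $|f|\in\Lambda_{\omega,p}(\overline{\mathbb{D}})$. (B4) $u\in\Lambda_{\omega,p}(\overline{\mathbb{D}})$. (B5) $|u|\in\Lambda_{\omega,p}(\overline{\mathbb{D}})$. (B6) $v\in\Lambda_{\omega,p}(\overline{\mathbb{D}})$. (B7) $|v|\in\Lambda_{\omega,p}(\overline{\mathbb{D}})$. (B8) There is a constant $M>0$ such that $\mathscr{Y}_{u,q,p}(z)\le M\,\frac{\omega(d_{\mathbb{D}}(z))}{d_{\mathbb{D}}(z)}$ for all $z\in\mathbb{D}$. (B9) There is a constant $M>0$ such that $\mathscr{Y}_{v,q,p}(z)\le M\,\frac{\omega(d_{\mathbb{D}}(z))}{d_{\mathbb{D}}(z)}$ for all $z\in\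mathbb{D}$.
   Context: $\mathbb{D}$ is the open unit disk in $\mathbb{C}$, $\mathbb{T}=\partial\mathbb{D}$, $\mathbb{D}(a,\rho)=\{z:|z-a|<\rho\}$, and $d_{\mathbb{D}}(z)=1-|z|$. $\mathscr{A}(\mathbb{D})$ is the disk algebra: functions analytic in $\mathbb{D}$ and continuous up to the boundary. For a differentiable function $F$, $\mathscr{M}_F(z)=|F_z(z)|+|F_{\overline z}(z)|$, where $F_z=\frac12(F_x-iF_y)$, $F_{\overline z}=\frac12(F_x+iF_y)$. A majorant is a continuous increasing function $\omega:[0,\infty)\to[0,\infty)$ with $\omega(0)=0$ such that $\omega(t)/t$ is non-increasing for $t>0$. It is fast if, for some $\delta_0>0$ and $M>0$, $\int_0^\delta\frac{\omega(t)}{t}\,dt\le M\omega(\delta)$ for all $0<\delta<\delta_0$. For $p\in(0,\infty)$ put $\mathcal{L}_p[F](z_1,z_2)=\left(\int_0^{2\pi}|F(e^{i\eta}z_1)-F(e^{i\eta}z_2)|^p\,d\eta\right)^{1/p}$, and put $\mathcal{L}_\infty[F](z_1,z_2)=|F(z_1)-F(z_2)|$. $\Lambda_{\omega,p}(\overline{\mathbb{D}})$ is the class of Borel functions $F:\overline{\mathbb{D}}\to\mathbb{C}$ for which there is $M>0$ with $\mathcal{L}_p[F](z_1,z_2)\le M\omega(|z_1-z_2|)$ for all $z_1,z_2\in\overline{\mathbb{D}}$ (functions in $\mathbb{D}$ continuous up to $\mathbb{T}$ are identified with their continuous extensions). For a real harmonic function $w$ in $\mathbb{D}$ and $B_z=\mathbb{D}(z,d_{\mathbb{D}}(z)/2)$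 with area $|B_z|$, and $dA$ Lebesgue area measure: $\mathscr{Y}_{w,q,p}(z)=\left(\int_0^{2\pi}\left(\frac{1}{|B_z|}\int_{B_z}(\mathscr{M}_w(\xi e^{i\eta}))^q\,dA(\xi)\right)^{p/q}d\eta\right)^{1/p}$ if $0<q\le p<\infty$, and $\mathscr{Y}_{w,q,\infty}(z)=\left(\frac{1}{|B_z|}\int_{B_z}(\mathscr{M}_w(\xi))^q\,dA(\xi)\right)^{1/q}$ if $0<q<p=\infty$. *)

theory Defs
  imports "HOL-Complex_Analysis.Complex_Analysis"
begin

definition disk_algebra :: "(complex \<Rightarrow> complex) set" where
  "disk_algebra = {f. f holomorphic_on ball 0 1 \<and> continuous_on (cball 0 1) f}"

definition disk_dist :: "complex \<Rightarrow> real" where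
  "disk_dist z = 1 - cmod z"

definition wirtinger :: "(complex \<Rightarrow> complex) \<Rightarrow> complex \<Rightarrow> complex" where
  "wirtinger F z =
     (frechet_derivative F (at z) 1 - \<i> * frechet_derivative F (at z) \<i>) / 2"

definition wirtinger_bar :: "(complex \<Rightarrow> complex) \<Rightarrow> complex \<Rightarrow> complex" where
  "wirtinger_bar F z =
     (frechet_derivative F (at z) 1 + \<i> * frechet_derivative F (at z) \<i>) / 2"

definition max_dilation :: "(complex \<Rightarrow> complex) \<Rightarrow> complex \<Rightarrow> real" where
  "max_dilation F z = cmod (wirtinger F z) + cmod (wirtinger_bar F z)"

definition majorant :: "(real \<Rightarrow> real) \<Rightarrow> bool" where
  "majorant \<omega> \<longleftrightarrow>
     continuous_on {0..} \<omega> \<and> mono_on {0..} \<omega> \<and> (\<forall>t\<ge>0. 0 \<le> \<omega> t) \<and> \<omega> 0 = 0 \<and>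
     antimono_on {0<..} (\<lambda>t. \<omega> t / t)"

text \<open>The integral of \<open>\<omega>(t)/t\<close> may diverge at 0, in which case \<open>\<omega>\<close> is not fast; hence the
  \<open>[0,\<infinity>]\<close>-valued integral.\<close>

definition fast_majorant :: "(real \<Rightarrow> real) \<Rightarrow> bool" where
  "fast_majorant \<omega> \<longleftrightarrow> majorant \<omega> \<and>
     (\<exists>\<delta>\<^sub>0>0. \<exists>M>0. \<forall>\<delta>. 0 < \<delta> \<and> \<delta> < \<delta>\<^sub>0 \<longrightarrow>
        (\<integral>\<^sup>+t\<in>{0<..<\<delta>}. ennreal (\<omega> t / t) \<partial>lborel) \<le> ennreal (M * \<omega> \<delta>))"

text \<open>Powers of extended nonnegative reals, for exponents \<open>a > 0\<close>.\<close>

definition ennreal_powr :: "ennreal \<Rightarrow> real \<Rightarrow> ennreal" where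
  "ennreal_powr x a = (if x = \<infinity> then \<infinity> else ennreal (enn2real x powr a))"

text \<open>All means below range over \<open>[0,\<infinity>]\<close>, so that a divergent integral has the value \<open>\<infinity>\<close>
  and fails every finite upper bound. The exponent \<open>p\<close> ranges over \<open>(0,\<infinity>]\<close>; for \<open>p = \<infinity>\<close> each
  mean is by convention a pointwise quantity, with no supremum over rotations.\<close>

definition circle_mean :: "ennreal \<Rightarrow> (complex \<Rightarrow> complex) \<Rightarrow> complex \<Rightarrow> ennreal" where
  "circle_mean p F z =
     (if p = \<infinity> then ennreal (cmod (F z))
      else ennreal_powr
        (\<integral>\<^sup>+\<eta>\<in>{0..2*pi}. ennreal (cmod (F (z * cis \<eta>)) powr enn2real p) \<partial>lborel)
        (1 / enn2real p))"

definition Lp_diff :: "ennreal \<Rightarrow> (complex \<Rightarrow> complex) \<Rightarrow> complex \<Rightarrow> complex \<Rightarrow> ennreal" where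
  "Lp_diff p F z\<^sub>1 z\<^sub>2 =
     (if p = \<infinity> then ennreal (cmod (F z\<^sub>1 - F z\<^sub>2))
      else ennreal_powr
        (\<integral>\<^sup>+\<eta>\<in>{0..2*pi}. ennreal (cmod (F (cis \<eta> * z\<^sub>1) - F (cis \<eta> * z\<^sub>2)) powr enn2real p) \<partial>lborel)
        (1 / enn2real p))"

text \<open>The class \<open>\<Lambda>\<^bsub>\<omega>,p\<^esub>\<close> on the closed unit disk; only the values of \<open>F\<close> on \<open>cball 0 1\<close> matter.\<close>

definition Lip_class :: "(real \<Rightarrow> real) \<Rightarrow> ennreal \<Rightarrow> (complex \<Rightarrow> complex) set" where
  "Lip_class \<omega> p = {F. F \<in> borel_measurable (restrict_space borel (cball 0 1)) \<and>
     (\<exists>M>0. \<forall>z\<^sub>1\<in>cball 0 1. \<forall>z\<^sub>2\<in>cball 0 1.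
        Lp_diff p F z\<^sub>1 z\<^sub>2 \<le> ennreal (M * \<omega> (cmod (z\<^sub>1 - z\<^sub>2))))}"

definition half_disk :: "complex \<Rightarrow> complex set" where
  "half_disk z = ball z (disk_dist z / 2)"

definition dilation_mean :: "(complex \<Rightarrow> real) \<Rightarrow> real \<Rightarrow> ennreal \<Rightarrow> complex \<Rightarrow> ennreal" where
  "dilation_mean w q p z =
     (let M = max_dilation (\<lambda>\<zeta>. complex_of_real (w \<zeta>)); B = half_disk z in
      if p = \<infinity> then
        ennreal_powr
          ((\<integral>\<^sup>+\<xi>\<in>B. ennreal (M \<xi> powr q) \<partial>lborel) / emeasure lborel B) (1 / q)
      else
        ennreal_powr
          (\<integral>\<^sup>+\<eta>\<in>{0..2*pi}.
             ennreal_powr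
               ((\<integral>\<^sup>+\<xi>\<in>B. ennreal (M (\<xi> * cis \<eta>) powr q) \<partial>lborel) / emeasure lborel B)
               (enn2real p / q) \<partial>lborel)
          (1 / enn2real p))"

definition majorant_growth :: "(real \<Rightarrow> real) \<Rightarrow> (complex \<Rightarrow> ennreal) \<Rightarrow> bool" where
  "majorant_growth \<omega> G \<longleftrightarrow>
     (\<exists>M>0. \<forall>z\<in>ball 0 1. G z \<le> ennreal (M * (\<omega> (disk_dist z) / disk_dist z)))"

end

theory Submission
  imports Defs
begin

text \<open>
  Every condition is compared with the growth condition on the derivative \<open>f'\<close>. Each comparison rests
  on a pointwise inequality, valid for every rotation \<open>\<eta>\<close>, that bounds one quantity by an integral of
  another over a circle, a segment or a disk. Minkowski's integral inequality
  (\<open>rot_bound_Minkowski\<close>) transfers it to \<open>L\<^sup>p\<close> norms in \<open>\<eta>\<close>.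

  \<^emph>\<open>From a Lipschitz condition to the growth of the derivative.\<close> Let \<open>g\<close> be one of \<open>|f|\<close>, \<open>u\<close>,
  \<open>|u|\<close>, \<open>v\<close>, \<open>|v|\<close>. For each point \<open>z\<close> of the disk there is a unimodular constant \<open>c\<close> such that
  \<open>Re (c f) \<le> g\<close> everywhere, with equality at \<open>z\<close>. The harmonic function \<open>Re (c f)\<close> has mean \<open>g z\<close>
  on every circle about \<open>z\<close>, so the nonnegative function \<open>g - Re (c f)\<close> has there the same mean as
  \<open>g - g z\<close>. Hence the mean of \<open>|Re (c f) - g z|\<close> is at most twice the mean of
  \<open>|g - g z|\<close>. Cauchy's formula recovers \<open>c f' z\<close> from the values of \<open>Re (c f)\<close> on the circle, so
  that \<open>|f' z|\<close> is controlled by the mean oscillation of \<open>g\<close> alone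
  (\<open>deriv_le_circle_oscillation\<close>). All five functions are covered by this one argument, and none of
  them oscillates more than \<open>f\<close> itself.

  \<^emph>\<open>From the growth of the derivative to a Lipschitz condition.\<close> This is the classical
  Hardy--Littlewood argument (\<open>Hardy_Littlewood_open_disk\<close>): integrate \<open>f'\<close> from \<open>z\<^sub>1\<close> radially
  inwards to \<open>(1 - s) z\<^sub>1\<close>, then along the segment to \<open>(1 - s) z\<^sub>2\<close>, then radially outwards to
  \<open>z\<^sub>2\<close>, where \<open>s\<close> is the smaller of \<open>|z\<^sub>1 - z\<^sub>2|\<close> and 1. On the middle segment the distance to
  the circle is at least \<open>s\<close>; on the radial segments the bound is the integral of \<open>\<omega> t / t\<close> over
  \<open>(0, s)\<close>, and it is here that the majorant has to be fast.

  \<^emph>\<open>Area means.\<close> The dilation of \<open>u\<close> and of \<open>v\<close> is \<open>|f'|\<close>. Its area means are bounded by Minkowski's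
  inequality for the exponent \<open>p / q \<ge> 1\<close>. Conversely \<open>|f' z|\<close> to the power \<open>q\<close> is at most a constant
  times the mean of \<open>|f'|\<close> to the power \<open>q\<close> over the disk about \<open>z\<close>, for every \<open>q > 0\<close>
  (\<open>power_submean\<close>).
\<close>

section \<open>Minkowski's integral inequality\<close>

text \<open>
  Young's inequality in the form of the tangent line to \<open>x powr P\<close> at \<open>c\<close>. The product form avoids
  division by \<open>c\<close>, so that \<open>c = 0\<close> is allowed.
\<close>

lemma Youngs_powr:
  fixes x c P :: real
  assumes "1 \<le> P" "0 \<le> x" "0 \<le> c"
  shows "P * (c powr (P - 1) * x) \<le> x powr P + (P - 1) * c powr P"
proof (cases "P = 1")
  case True then show ?thesis using assms by simp
next
  case False
  then have P: "P > 1" using assms by simp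
  define Q where "Q = P / (P - 1)"
  have Q: "Q > 1" "1/P + 1/Q = 1" "(P-1) * Q = P" using P by (auto simp: Q_def field_simps)
  have "x * c powr (P - 1) \<le> x powr P / P + (c powr (P-1)) powr Q / Q"
    using assms P Q by (intro Youngs_inequality) auto
  also have "(c powr (P-1)) powr Q / Q = (P - 1) * c powr P / P"
    using P Q by (simp add: powr_powr Q_def)
  finally show ?thesis using P by (simp add: field_simps)
qed

text \<open>
  The proof is Jensen's inequality with the weight \<open>K\<close>, carried out by hand. Young's inequality for
  \<open>h / K\<close>, with the tangent point \<open>c = G / S\<close> chosen separately for each \<open>x\<close>, integrates to
  \<open>G\<^sup>P \<le> S\<^sup>P\<^sup>-\<^sup>1 \<integral> h\<^sup>P K\<^sup>1\<^sup>-\<^sup>P\<close>; integration over \<open>x\<close> and Tonelli's theorem give the claim.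
  Here \<open>G\<close> is any finite function below the integral of \<open>h\<close>, which may itself be infinite.
\<close>

lemma Minkowski_integral_pos:
  fixes h :: "'a \<Rightarrow> 'b \<Rightarrow> real"
  assumes "sigma_finite_measure M" "sigma_finite_measure N" and P: "1 \<le> P"
    and h [measurable]: "(\<lambda>(t, x). h t x) \<in> borel_measurable (M \<Otimes>\<^sub>M N)"
    and h0: "\<And>t x. 0 \<le> h t x"
    and K [measurable]: "K \<in> borel_measurable M" and K0: "\<And>t. t \<in> space M \<Longrightarrow> 0 < K t"
    and hK: "\<And>t. t \<in> space M \<Longrightarrow> (\<integral>\<^sup>+x. ennreal (h t x powr P) \<partial>N) \<le> ennreal (K t powr P)"
    and S: "(\<integral>\<^sup>+t. ennreal (K t) \<partial>M) \<le> ennreal S" "0 < S"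
    and G: "\<And>x. x \<in> space N \<Longrightarrow> 0 \<le> G x"
           "\<And>x. x \<in> space N \<Longrightarrow> ennreal (G x) \<le> (\<integral>\<^sup>+t. ennreal (h t x) \<partial>M)"
  shows "(\<integral>\<^sup>+x. ennreal (G x powr P) \<partial>N) \<le> ennreal (S powr P)"
proof -
  interpret M: sigma_finite_measure M by fact
  interpret N: sigma_finite_measure N by fact
  interpret MN: pair_sigma_finite M N ..
  define W where "W t x = h t x powr P * K t powr (1 - P)" for t x
  have W0: "W t x \<ge> 0" for t x by (simp add: W_def)
  have W [measurable]: "(\<lambda>(t, x). W t x) \<in> borel_measurable (M \<Otimes>\<^sub>M N)"
    unfolding W_def by measurable
  have pt: "ennreal (G x powr P) \<le> ennreal (S powr (P - 1)) * (\<integral>\<^sup>+t. ennreal (W t x) \<partial>M)"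
    if x: "x \<in> space N" for x
  proof -
    have [measurable]: "(\<lambda>t. h t x) \<in> borel_measurable M" "(\<lambda>t. W t x) \<in> borel_measurable M"
      using x by measurable
    define c where "c = G x / S"
    have c: "c \<ge> 0" "c * S = G x" using S(2) G(1)[OF x] by (auto simp: c_def)
    have A: "(\<integral>\<^sup>+t. ennreal (P * c powr (P - 1)) * ennreal (h t x) \<partial>M)
       \<le> (\<integral>\<^sup>+t. ennreal (W t x) + ennreal ((P - 1) * c powr P) * ennreal (K t) \<partial>M)"
    proof (rule nn_integral_mono)
      fix t assume t: "t \<in> space M"
      have Kt: "K t > 0" using K0[OF t] .
      have "P * (c powr (P - 1) * (h t x / K t)) * K t
        \<le> ((h t x / K t) powr P + (P - 1) * c powr P) * K t"
        using Kt h0[of t x] by (intro mult_right_mono Youngs_powr P c) auto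
      also have "\<dots> = W t x + (P - 1) * c powr P * K t"
        using Kt h0[of t x] by (simp add: W_def powr_divide powr_diff field_simps)
      finally have "P * c powr (P - 1) * h t x \<le> W t x + (P - 1) * c powr P * K t"
        using Kt by (simp add: mult_ac)
      then show "ennreal (P * c powr (P - 1)) * ennreal (h t x)
        \<le> ennreal (W t x) + ennreal ((P - 1) * c powr P) * ennreal (K t)"
        using P Kt W0[of t x] h0[of t x]
        by (simp flip: ennreal_mult ennreal_plus add: ennreal_leI)
    qed
    have "ennreal (P * c powr (P - 1)) * ennreal (G x)
        \<le> ennreal (P * c powr (P - 1)) * (\<integral>\<^sup>+t. ennreal (h t x) \<partial>M)"
      by (intro mult_left_mono G x) auto
    also have "\<dots> \<le> (\<integral>\<^sup>+t. ennreal (W t x) \<partial>M) + ennreal ((P - 1) * c powr P) * (\<integral>\<^sup>+t. ennreal (K t) \<partial>M)"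
      using A by (simp add: nn_integral_add nn_integral_cmult)
    also have "\<dots> \<le> (\<integral>\<^sup>+t. ennreal (W t x) \<partial>M) + ennreal ((P - 1) * c powr P) * ennreal S"
      by (intro add_left_mono mult_left_mono S) auto
    finally have B: "ennreal (P * c powr (P - 1)) * ennreal (G x)
      \<le> (\<integral>\<^sup>+t. ennreal (W t x) \<partial>M) + ennreal ((P - 1) * c powr P) * ennreal S" .
    have eq: "P * c powr (P - 1) * G x = c powr P * S + (P - 1) * c powr P * S"
    proof (cases "c = 0")
      case False
      then show ?thesis using c P by (simp flip: c(2) add: powr_diff field_simps)
    qed (use c in auto)
    have B': "ennreal (c powr P * S) + ennreal ((P - 1) * c powr P * S)
       \<le> (\<integral>\<^sup>+t. ennreal (W t x) \<partial>M) + ennreal ((P - 1) * c powr P * S)"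
      using B P G(1)[OF x] S(2) by (simp flip: ennreal_mult ennreal_plus add: eq)
    then have "ennreal (c powr P * S) \<le> (\<integral>\<^sup>+t. ennreal (W t x) \<partial>M)"
      by (simp add: ennreal_add_left_cancel_le add.commute)
    then have "ennreal (S powr (P - 1)) * ennreal (c powr P * S)
       \<le> ennreal (S powr (P - 1)) * (\<integral>\<^sup>+t. ennreal (W t x) \<partial>M)"
      by (intro mult_left_mono) auto
    moreover have "S powr (P - 1) * (c powr P * S) = G x powr P"
      using S(2) G(1)[OF x] by (simp add: c_def powr_divide powr_diff)
    ultimately show ?thesis using S(2) by (simp flip: ennreal_mult)
  qed
  have "(\<integral>\<^sup>+x. ennreal (G x powr P) \<partial>N)
      \<le> (\<integral>\<^sup>+x. ennreal (S powr (P - 1)) * (\<integral>\<^sup>+t. ennreal (W t x) \<partial>M) \<partial>N)"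
    by (intro nn_integral_mono pt)
  also have "\<dots> = ennreal (S powr (P - 1)) * (\<integral>\<^sup>+x. (\<integral>\<^sup>+t. ennreal (W t x) \<partial>M) \<partial>N)"
    by (intro nn_integral_cmult) measurable
  also have "(\<integral>\<^sup>+x. (\<integral>\<^sup>+t. ennreal (W t x) \<partial>M) \<partial>N) = (\<integral>\<^sup>+t. (\<integral>\<^sup>+x. ennreal (W t x) \<partial>N) \<partial>M)"
    by (rule MN.Fubini') measurable
  also have "\<dots> \<le> (\<integral>\<^sup>+t. ennreal (K t) \<partial>M)"
  proof (rule nn_integral_mono)
    fix t assume t: "t \<in> space M"
    have [measurable]: "(\<lambda>x. h t x) \<in> borel_measurable N" using t by measurable
    have "(\<integral>\<^sup>+x. ennreal (W t x) \<partial>N) = (\<integral>\<^sup>+x. ennreal (h t x powr P) \<partial>N) * ennreal (K t powr (1 - P))"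
      unfolding W_def by (subst nn_integral_multc[symmetric]) (auto simp: ennreal_mult)
    also have "\<dots> \<le> ennreal (K t powr P) * ennreal (K t powr (1 - P))"
      by (intro mult_right_mono hK t) auto
    also have "\<dots> = ennreal (K t)"
      using K0[OF t] by (simp flip: ennreal_mult powr_add)
    finally show "(\<integral>\<^sup>+x. ennreal (W t x) \<partial>N) \<le> ennreal (K t)" .
  qed
  also note S(1)
  finally have "(\<integral>\<^sup>+x. ennreal (G x powr P) \<partial>N) \<le> ennreal (S powr (P - 1)) * ennreal S"
    by (simp add: mult_left_mono)
  also have "\<dots> = ennreal (S powr P)"
    using S(2) by (simp flip: ennreal_mult add: powr_diff)
  finally show ?thesis .
qed

text \<open>
  On a finite measure space a nonnegative weight \<open>K\<close> can be replaced by the positive weight \<open>K + e\<close>,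
  with \<open>e\<close> tending to 0 afterwards. This covers the majorant that vanishes identically.
\<close>

lemma Minkowski_integral:
  fixes h :: "'a \<Rightarrow> 'b \<Rightarrow> real"
  assumes "finite_measure M" "sigma_finite_measure N" and P: "1 \<le> P"
    and h: "(\<lambda>(t, x). h t x) \<in> borel_measurable (M \<Otimes>\<^sub>M N)"
    and h0: "\<And>t x. 0 \<le> h t x"
    and K [measurable]: "K \<in> borel_measurable M" and K0: "\<And>t. t \<in> space M \<Longrightarrow> 0 \<le> K t"
    and hK: "\<And>t. t \<in> space M \<Longrightarrow> (\<integral>\<^sup>+x. ennreal (h t x powr P) \<partial>N) \<le> ennreal (K t powr P)"
    and S: "(\<integral>\<^sup>+t. ennreal (K t) \<partial>M) \<le> ennreal S" "0 \<le> S"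
    and G: "\<And>x. x \<in> space N \<Longrightarrow> 0 \<le> G x"
           "\<And>x. x \<in> space N \<Longrightarrow> ennreal (G x) \<le> (\<integral>\<^sup>+t. ennreal (h t x) \<partial>M)"
  shows "(\<integral>\<^sup>+x. ennreal (G x powr P) \<partial>N) \<le> ennreal (S powr P)"
proof -
  interpret finite_measure M by fact
  define m where "m = measure M (space M)"
  have m: "emeasure M (space M) = ennreal m" "m \<ge> 0" by (auto simp: m_def emeasure_eq_measure)
  have "(\<integral>\<^sup>+x. ennreal (G x powr P) \<partial>N) \<le> ennreal ((S + e * (m + 1)) powr P)" if e: "e > 0" for e
  proof (rule Minkowski_integral_pos[OF _ assms(2) P h h0, where K = "\<lambda>t. K t + e"])
    fix t assume t: "t \<in> space M"
    have "K t powr P \<le> (K t + e) powr P" using K0[OF t] e P by (intro powr_mono2) auto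
    then show "(\<integral>\<^sup>+x. ennreal (h t x powr P) \<partial>N) \<le> ennreal ((K t + e) powr P)"
      using hK[OF t] by (meson ennreal_leI order_trans)
    show "0 < K t + e" using K0[OF t] e by simp
  next
    have "(\<integral>\<^sup>+t. ennreal (K t + e) \<partial>M) = (\<integral>\<^sup>+t. ennreal (K t) + ennreal e \<partial>M)"
      using e K0 by (intro nn_integral_cong) auto
    also have "\<dots> = (\<integral>\<^sup>+t. ennreal (K t) \<partial>M) + ennreal e * ennreal m"
      by (simp add: nn_integral_add m)
    also have "\<dots> \<le> ennreal S + ennreal e * ennreal m" by (intro add_right_mono S)
    also have "\<dots> \<le> ennreal (S + e * (m + 1))"
      using e S m by (simp flip: ennreal_plus ennreal_mult add: field_simps)
    finally show "(\<integral>\<^sup>+t. ennreal (K t + e) \<partial>M) \<le> ennreal (S + e * (m + 1))" .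
    show "0 < S + e * (m + 1)" using e S m by (simp add: add_nonneg_pos)
  qed (use G sigma_finite_measure_axioms in auto)
  moreover have "((\<lambda>e. ennreal ((S + e * (m + 1)) powr P)) \<longlongrightarrow> ennreal ((S + 0 * (m + 1)) powr P)) (at_right 0)"
    using S m P by (intro tendsto_ennrealI tendsto_powr2 tendsto_intros)
      (auto simp: eventually_at_right_field intro!: exI[of _ 1])
  ultimately show ?thesis
    by (intro tendsto_lowerbound[where F = "at_right (0::real)" and f = "\<lambda>e. ennreal ((S + e * (m + 1)) powr P)"])
       (auto simp: eventually_at_right_field intro!: exI[of _ 1])
qed

section \<open>Rotation invariance of planar Lebesgue measure\<close>

text \<open>
  Identifies the plane measure with the product measure, which makes Tonelli's theorem available in
  Cartesian coordinates.
\<close>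

lemma distr_Complex_lborel:
  "distr (lborel \<Otimes>\<^sub>M lborel) borel (\<lambda>(x, y). Complex x y) = (lborel :: complex measure)"
proof (rule lborel_eqI[symmetric])
  have [measurable]: "(\<lambda>(x, y). Complex x y) \<in> (lborel \<Otimes>\<^sub>M lborel) \<rightarrow>\<^sub>M borel"
    unfolding Complex_eq by measurable
  fix l u :: complex
  assume le: "\<And>b. b \<in> Basis \<Longrightarrow> l \<bullet> b \<le> u \<bullet> b"
  have le': "Re l \<le> Re u" "Im l \<le> Im u"
    using le[of 1] le[of \<i>] by (auto simp: Basis_complex_def)
  have "(\<lambda>(x, y). Complex x y) -` box l u = {Re l<..<Re u} \<times> {Im l<..<Im u}"
    by (auto simp: box_def Basis_complex_def)
  then have "emeasure (distr (lborel \<Otimes>\<^sub>M lborel) borel (\<lambda>(x, y). Complex x y)) (box l u)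
      = emeasure (lborel \<Otimes>\<^sub>M lborel) ({Re l<..<Re u} \<times> {Im l<..<Im u})"
    by (subst emeasure_distr) (auto simp: space_pair_measure)
  also have "\<dots> = ennreal ((Re u - Re l) * (Im u - Im l))"
    using le' by (subst lborel.emeasure_pair_measure_Times) (auto simp: ennreal_mult)
  also have "\<dots> = ennreal (\<Prod>b\<in>Basis. (u - l) \<bullet> b)"
    by (simp add: Basis_complex_def complex_i_not_one[symmetric] del: complex_i_not_one)
  finally show "emeasure (distr (lborel \<Otimes>\<^sub>M lborel) borel (\<lambda>(x, y). Complex x y)) (box l u)
      = ennreal (\<Prod>b\<in>Basis. (u - l) \<bullet> b)" .
qed simp

lemma measurable_Complex [measurable (raw)]:
  assumes [measurable]: "f \<in> borel_measurable M" "g \<in> borel_measurable M"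
  shows "(\<lambda>x. Complex (f x) (g x)) \<in> borel_measurable M"
  unfolding Complex_eq by measurable

lemma nn_integral_complex:
  assumes [measurable]: "F \<in> borel_measurable borel"
  shows "(\<integral>\<^sup>+z. F z \<partial>lborel) = (\<integral>\<^sup>+x. \<integral>\<^sup>+y. F (Complex x y) \<partial>lborel \<partial>lborel)"
    and "(\<integral>\<^sup>+z. F z \<partial>lborel) = (\<integral>\<^sup>+y. \<integral>\<^sup>+x. F (Complex x y) \<partial>lborel \<partial>lborel)"
proof -
  have "(\<integral>\<^sup>+z. F z \<partial>lborel) = (\<integral>\<^sup>+z. F (Complex (fst z) (snd z)) \<partial>(lborel \<Otimes>\<^sub>M lborel))"
    by (subst distr_Complex_lborel[symmetric], subst nn_integral_distr) (auto simp: case_prod_beta')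
  then show "(\<integral>\<^sup>+z. F z \<partial>lborel) = (\<integral>\<^sup>+x. \<integral>\<^sup>+y. F (Complex x y) \<partial>lborel \<partial>lborel)"
    by (simp add: lborel.nn_integral_fst[symmetric])
  also have "\<dots> = (\<integral>\<^sup>+y. \<integral>\<^sup>+x. F (Complex x y) \<partial>lborel \<partial>lborel)"
    by (rule lborel_pair.Fubini'[symmetric]) measurable
  finally show "(\<integral>\<^sup>+z. F z \<partial>lborel) = (\<integral>\<^sup>+y. \<integral>\<^sup>+x. F (Complex x y) \<partial>lborel \<partial>lborel)" .
qed

lemma nn_integral_shear:
  fixes F :: "complex \<Rightarrow> ennreal"
  assumes [measurable]: "F \<in> borel_measurable borel"
  shows nn_integral_shear_Re: "(\<integral>\<^sup>+z. F (Complex (Re z + k * Im z) (Im z)) \<partial>lborel) = (\<integral>\<^sup>+z. F z \<partial>lborel)"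
    and nn_integral_shear_Im: "(\<integral>\<^sup>+z. F (Complex (Re z) (Im z + k * Re z)) \<partial>lborel) = (\<integral>\<^sup>+z. F z \<partial>lborel)"
proof -
  have shift: "(\<integral>\<^sup>+x. G (x + a) \<partial>lborel) = (\<integral>\<^sup>+x. G x \<partial>lborel)"
    if "G \<in> borel_measurable borel" for G :: "real \<Rightarrow> ennreal" and a
    using nn_integral_real_affine[OF that, of 1 a] by (simp add: add.commute)
  show "(\<integral>\<^sup>+z. F (Complex (Re z + k * Im z) (Im z)) \<partial>lborel) = (\<integral>\<^sup>+z. F z \<partial>lborel)"
    by (simp add: nn_integral_complex(2) shift[where G = "\<lambda>x. F (Complex x _)"])
  show "(\<integral>\<^sup>+z. F (Complex (Re z) (Im z + k * Re z)) \<partial>lborel) = (\<integral>\<^sup>+z. F z \<partial>lborel)"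
    by (simp add: nn_integral_complex(1) shift[where G = "\<lambda>y. F (Complex _ y)"])
qed

text \<open>
  A rotation is a product of three shears: horizontally by \<open>k\<close>, vertically by \<open>Im c\<close>, horizontally
  by \<open>k\<close> again, where \<open>k = (Re c - 1) / Im c\<close>. A shear preserves the measure by Tonelli's theorem
  and the translation invariance of one-dimensional Lebesgue measure.
\<close>

lemma nn_integral_rotate_nonreal:
  fixes F :: "complex \<Rightarrow> ennreal"
  assumes F [measurable]: "F \<in> borel_measurable borel" and c: "cmod c = 1" "Im c \<noteq> 0"
  shows "(\<integral>\<^sup>+z. F (c * z) \<partial>lborel) = (\<integral>\<^sup>+z. F z \<partial>lborel)"
proof -
  define k where "k = (Re c - 1) / Im c"
  have ab: "(Re c)\<^sup>2 + (Im c)\<^sup>2 = 1" using c(1) by (simp add: cmod_def)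
  define A where "A z = Complex (Re z + k * Im z) (Im z)" for z
  define B where "B z = Complex (Re z) (Im z + Im c * Re z)" for z
  have [measurable]: "A \<in> borel_measurable borel" "B \<in> borel_measurable borel"
    unfolding A_def B_def by measurable
  have kc: "1 + k * Im c = Re c" using c(2) by (simp add: k_def)
  have kk: "k + k * Re c = - Im c"
  proof -
    have "k * (1 + Re c) = ((Re c)\<^sup>2 - 1) / Im c" by (simp add: k_def field_simps power2_eq_square)
    also have "\<dots> = - Im c" using ab c(2) by (simp add: field_simps power2_eq_square)
    finally show ?thesis by (simp add: algebra_simps)
  qed
  have "c * z = A (B (A z))" for z
  proof (rule complex_eqI)
    have "Re (A (B (A z))) = (1 + k * Im c) * Re z + (k + k * (1 + k * Im c)) * Im z"
      by (simp add: A_def B_def algebra_simps)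
    then show "Re (c * z) = Re (A (B (A z)))" unfolding kc kk by simp
    have "Im (A (B (A z))) = Im c * Re z + (1 + k * Im c) * Im z"
      by (simp add: A_def B_def algebra_simps)
    then show "Im (c * z) = Im (A (B (A z)))" unfolding kc by simp
  qed
  then have "(\<integral>\<^sup>+z. F (c * z) \<partial>lborel) = (\<integral>\<^sup>+z. F (A (B (A z))) \<partial>lborel)" by simp
  also have "\<dots> = (\<integral>\<^sup>+z. F (A (B z)) \<partial>lborel)"
    using nn_integral_shear_Re[of "\<lambda>z. F (A (B z))" k] by (simp add: A_def)
  also have "\<dots> = (\<integral>\<^sup>+z. F (A z) \<partial>lborel)"
    using nn_integral_shear_Im[of "\<lambda>z. F (A z)" "Im c"] by (simp add: B_def)
  also have "\<dots> = (\<integral>\<^sup>+z. F z \<partial>lborel)"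
    using nn_integral_shear_Re[of F k] by (simp add: A_def)
  finally show ?thesis .
qed

lemma nn_integral_rotate:
  fixes F :: "complex \<Rightarrow> ennreal"
  assumes F [measurable]: "F \<in> borel_measurable borel" and c: "cmod c = 1"
  shows "(\<integral>\<^sup>+z. F (c * z) \<partial>lborel) = (\<integral>\<^sup>+z. F z \<partial>lborel)"
proof (cases "Im c = 0")
  case True
  \<comment> \<open>Here \<open>c = \<plusminus>1\<close> is the product of the non-real numbers \<open>c * \<i>\<close> and \<open>-\<i>\<close>.\<close>
  have "Re c \<noteq> 0" using True c by (auto simp: cmod_def)
  have "(\<integral>\<^sup>+z. F (c * z) \<partial>lborel) = (\<integral>\<^sup>+z. F ((c * \<i>) * (- \<i> * z)) \<partial>lborel)" by (simp add: mult.assoc)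
  also have "\<dots> = (\<integral>\<^sup>+z. F ((c * \<i>) * z) \<partial>lborel)"
    by (rule nn_integral_rotate_nonreal[where F = "\<lambda>z. F ((c * \<i>) * z)"]) auto
  also have "\<dots> = (\<integral>\<^sup>+z. F z \<partial>lborel)"
    using \<open>Re c \<noteq> 0\<close> c by (intro nn_integral_rotate_nonreal) (auto simp: norm_mult)
  finally show ?thesis .
qed (use nn_integral_rotate_nonreal assms in blast)

lemma nn_integral_translate:
  fixes F :: "complex \<Rightarrow> ennreal"
  assumes F [measurable]: "F \<in> borel_measurable borel"
  shows "(\<integral>\<^sup>+z. F (a + z) \<partial>lborel) = (\<integral>\<^sup>+z. F z \<partial>lborel)"
  by (subst lborel_distr_plus[of a, symmetric], subst nn_integral_distr) auto

lemma nn_integral_rotate_about: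
  fixes F :: "complex \<Rightarrow> ennreal"
  assumes F [measurable]: "F \<in> borel_measurable borel" and c: "cmod c = 1"
  shows "(\<integral>\<^sup>+\<zeta>. F (a + c * (\<zeta> - a)) \<partial>lborel) = (\<integral>\<^sup>+\<zeta>. F \<zeta> \<partial>lborel)"
proof -
  have "(\<integral>\<^sup>+\<zeta>. F (a + c * (\<zeta> - a)) \<partial>lborel) = (\<integral>\<^sup>+\<zeta>. F (a + c * \<zeta>) \<partial>lborel)"
    using nn_integral_translate[of "\<lambda>\<zeta>. F (a + c * \<zeta>)" "-a"] by simp
  also have "\<dots> = (\<integral>\<^sup>+\<zeta>. F (a + \<zeta>) \<partial>lborel)" by (rule nn_integral_rotate) (use c in auto)
  also have "\<dots> = (\<integral>\<^sup>+\<zeta>. F \<zeta> \<partial>lborel)" by (rule nn_integral_translate) simp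
  finally show ?thesis .
qed

section \<open>Cauchy's formula for the derivative in terms of a real majorant\<close>

lemma norm_has_integral_le_nn_integral:
  fixes \<phi> :: "real \<Rightarrow> complex"
  assumes I: "(\<phi> has_integral I) {a..b}" and cont: "continuous_on {a..b} \<phi>"
  shows "ennreal (cmod I) \<le> (\<integral>\<^sup>+t\<in>{a..b}. ennreal (cmod (\<phi> t)) \<partial>lborel)"
proof -
  have int: "set_integrable lborel {a..b} \<phi>"
    by (rule borel_integrable_atLeastAtMost'[OF cont])
  have "I = (LINT t:{a..b}|lborel. \<phi> t)"
    using set_borel_integral_eq_integral(2)[OF int] I by (simp add: integral_unique)
  also have "ennreal (cmod \<dots>) \<le> (\<integral>\<^sup>+t. ennreal (cmod (indicator {a..b} t *\<^sub>R \<phi> t)) \<partial>lborel)"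
    unfolding set_lebesgue_integral_def
    by (rule integral_norm_bound_ennreal) (use int in \<open>simp add: set_integrable_def\<close>)
  also have "\<dots> = (\<integral>\<^sup>+t\<in>{a..b}. ennreal (cmod (\<phi> t)) \<partial>lborel)"
    by (intro nn_integral_cong) (auto simp: indicator_def)
  finally show ?thesis .
qed

context
  fixes F :: "complex \<Rightarrow> complex" and z :: complex and r :: real
  assumes r: "0 < r" and contF: "continuous_on (cball z r) F" and holF: "F holomorphic_on ball z r"
begin

lemma circle_mean_value: "((\<lambda>t. F (z + r * cis t)) has_integral 2 * pi * F z) {0..2*pi}"
proof -
  have "((\<lambda>u. F u / (u - z)) has_contour_integral (2 * of_real pi * \<i> * F z)) (part_circlepath z r 0 (2 * pi))"
    using Cauchy_integral_circlepath[OF contF holF, of z] r by (simp add: circlepath_def)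
  then have "((\<lambda>t. F (z + r * cis t) / (z + r * cis t - z) * r * \<i> * cis t) has_integral (2 * of_real pi * \<i> * F z)) {0..2*pi}"
    by (subst (asm) has_contour_integral_part_circlepath_iff) auto
  then have "((\<lambda>t. - \<i> * (F (z + r * cis t) / (z + r * cis t - z) * r * \<i> * cis t)) has_integral - \<i> * (2 * of_real pi * \<i> * F z)) {0..2*pi}"
    by (rule has_integral_mult_right)
  then show ?thesis using r by (simp add: field_simps)
qed

lemma circle_integral_cis: "((\<lambda>t. F (z + r * cis t) * cis t) has_integral 0) {0..2*pi}"
proof -
  have "(F has_contour_integral 0) (circlepath z r)"
    using r contF holF holomorphic_on_imp_differentiable_at
    by (intro Cauchy_theorem_convex[where S = "cball z r" and K = "{}"]) (auto simp: path_image_circlepath_minus)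
  then have "((\<lambda>t. F (z + r * cis t) * r * \<i> * cis t) has_integral 0) {0..2*pi}"
    unfolding circlepath_def by (subst (asm) has_contour_integral_part_circlepath_iff) auto
  then have "((\<lambda>t. (- \<i> / r) * (F (z + r * cis t) * r * \<i> * cis t)) has_integral (- \<i> / r) * 0) {0..2*pi}"
    by (rule has_integral_mult_right)
  then show ?thesis using r by (simp add: field_simps)
qed

lemma circle_integral_deriv:
  "((\<lambda>t. F (z + r * cis t) * cis (- t)) has_integral (2 * pi * r * deriv F z)) {0..2*pi}"
proof -
  let ?I = "contour_integral (circlepath z r) (\<lambda>u. F u / (u - z)\<^sup>2)"
  have 1: "(\<lambda>u. F u / (u - z)\<^sup>2) contour_integrable_on (circlepath z r)"
    and 2: "(F has_field_derivative (1 / (2 * of_real pi * \<i>) * ?I)) (at z)"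
    using Cauchy_derivative_integral_circlepath[OF contF holF, of z] r by auto
  have I: "?I = 2 * pi * \<i> * deriv F z" using DERIV_imp_deriv[OF 2] by simp
  have "((\<lambda>u. F u / (u - z)\<^sup>2) has_contour_integral (2 * pi * \<i> * deriv F z)) (part_circlepath z r 0 (2 * pi))"
    using has_contour_integral_integral[OF 1, unfolded I] by (simp add: circlepath_def)
  then have "((\<lambda>t. F (z + r * cis t) / (z + r * cis t - z)\<^sup>2 * r * \<i> * cis t) has_integral (2 * pi * \<i> * deriv F z)) {0..2*pi}"
    by (subst (asm) has_contour_integral_part_circlepath_iff) auto
  then have "((\<lambda>t. - \<i> * r * (F (z + r * cis t) / (z + r * cis t - z)\<^sup>2 * r * \<i> * cis t)) has_integral - \<i> * r * (2 * pi * \<i> * deriv F z)) {0..2*pi}"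
    by (rule has_integral_mult_right)
  then show ?thesis using r by (simp add: field_simps power2_eq_square flip: cis_inverse)
qed

end

text \<open>
  Write \<open>U\<close> for \<open>Re (c F)\<close> on the circle. Adding Cauchy's formula for \<open>c F'\<close> to the conjugate of
  Cauchy's theorem eliminates \<open>Im (c F)\<close> and yields \<open>\<pi> r c F' z = \<integral> (U - g z) e\<^sup>-\<^sup>i\<^sup>t dt\<close>. In
  \<open>|U - g z| \<le> |g - g z| + (g - U)\<close> the last term is nonnegative, and its integral is that of
  \<open>g - g z\<close> because \<open>U\<close> has mean \<open>g z\<close>.
\<close>

lemma deriv_le_circle_oscillation:
  fixes F :: "complex \<Rightarrow> complex" and g :: "complex \<Rightarrow> real"
  assumes r: "0 < r" and contF: "continuous_on (cball z r) F" and holF: "F holomorphic_on ball z r"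
    and contg: "continuous_on (cball z r) g" and c: "cmod c = 1"
    and le: "\<And>\<zeta>. \<zeta> \<in> cball z r \<Longrightarrow> Re (c * F \<zeta>) \<le> g \<zeta>" and eq: "Re (c * F z) = g z"
  shows "ennreal (cmod (deriv F z))
    \<le> (\<integral>\<^sup>+t\<in>{0..2*pi}. ennreal (2 / (pi * r) * \<bar>g (z + r * cis t) - g z\<bar>) \<partial>lborel)"
proof -
  define U where "U t = Re (c * F (z + r * cis t))" for t
  define a where "a = g z"
  have mem: "z + r * cis t \<in> cball z r" for t using r by (simp add: dist_norm norm_mult)
  have contcF: "continuous_on {0..2*pi} (\<lambda>t. F (z + r * cis t))"
    by (rule continuous_on_compose2[OF contF]) (use mem in \<open>auto intro!: continuous_intros\<close>)
  have cg: "continuous_on {0..2*pi} (\<lambda>t. g (z + r * cis t))"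
    by (rule continuous_on_compose2[OF contg]) (use mem in \<open>auto intro!: continuous_intros\<close>)
  have cU: "continuous_on {0..2*pi} U"
    unfolding U_def by (intro continuous_intros contcF)
  have U: "(U has_integral 2 * pi * a) {0..2*pi}"
  proof -
    have "((\<lambda>t. Re (c * F (z + r * cis t))) has_integral Re (c * (2 * pi * F z))) {0..2*pi}"
      using has_integral_Re[OF has_integral_mult_right[OF circle_mean_value[OF r contF holF], of c]] .
    moreover have "Re (c * (2 * pi * F z)) = 2 * pi * a"
    proof -
      have "Re (of_real (2 * pi) * w) = 2 * pi * Re w" for w by simp
      moreover have "c * (2 * pi * F z) = of_real (2 * pi) * (c * F z)" by simp
      ultimately show ?thesis using eq by (simp only: a_def)
    qed
    ultimately show ?thesis by (simp add: U_def [abs_def])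
  qed
  have zero: "((\<lambda>t. cis (- t)) has_integral 0) {0..2*pi}"
  proof -
    have "((\<lambda>t. cis t) has_integral 0) {0..2*pi}"
      using circle_integral_cis[of 1 0 "\<lambda>_. 1"] by simp
    then show ?thesis using has_integral_cnj[of "\<lambda>t. cis t" 0 "{0..2*pi}"] by (simp add: cis_cnj o_def)
  qed
  have D: "((\<lambda>t. (U t - a) * cis (- t)) has_integral (pi * r * c * deriv F z)) {0..2*pi}"
  proof -
    have 1: "((\<lambda>t. c * (F (z + r * cis t) * cis (- t))) has_integral c * (2 * pi * r * deriv F z)) {0..2*pi}"
      by (rule has_integral_mult_right[OF circle_integral_deriv[OF r contF holF]])
    \<comment> \<open>Conjugation turns the vanishing integral against \<open>cis t\<close> into one against \<open>cis (- t)\<close>.\<close>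
    have 2: "((\<lambda>t. cnj (c * (F (z + r * cis t) * cis t))) has_integral cnj (c * 0)) {0..2*pi}"
      using has_integral_cnj[THEN iffD2, OF has_integral_mult_right[OF circle_integral_cis[OF r contF holF], of c]]
      by (simp only: o_def)
    have 3: "((\<lambda>t. (c * (F (z + r * cis t) * cis (- t)) + cnj (c * (F (z + r * cis t) * cis t))) / 2 - a * cis (-t))
       has_integral (c * (2 * pi * r * deriv F z) + cnj (c * 0)) / 2 - of_real a * 0) {0..2*pi}"
      by (intro has_integral_diff has_integral_divide has_integral_add 1 2 has_integral_mult_right[OF zero])
    have 4: "(c * (F w * cis (- t)) + cnj (c * (F w * cis t))) / 2 - a * cis (-t) = (Re (c * F w) - a) * cis (-t)" for w t
    proof -
      have "c * (F w * cis (- t)) + cnj (c * (F w * cis t)) = (c * F w + cnj (c * F w)) * cis (-t)"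
        by (simp add: cis_cnj algebra_simps)
      also have "\<dots> = of_real (2 * Re (c * F w)) * cis (-t)" by (simp only: complex_add_cnj)
      finally show ?thesis by (simp add: algebra_simps del: times_complex.sel)
    qed
    have 5: "(c * (2 * pi * r * deriv F z) + cnj (c * 0)) / 2 - of_real a * 0 = pi * r * c * deriv F z" by simp
    show ?thesis using 3 unfolding 4 5 U_def .
  qed
  let ?osc = "\<lambda>t. \<bar>g (z + r * cis t) - a\<bar>"
  have iosc: "?osc integrable_on {0..2*pi}"
    by (intro integrable_continuous_interval continuous_intros cg)
  have ig: "(\<lambda>t. g (z + r * cis t) - a) integrable_on {0..2*pi}"
    by (intro integrable_continuous_interval continuous_intros cg)
  have "pi * r * cmod (deriv F z) = cmod (pi * r * c * deriv F z)"
    using r c by (simp add: norm_mult)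
  also have "\<dots> = cmod (integral {0..2*pi} (\<lambda>t. (U t - a) * cis (- t)))"
    using D by (simp add: integral_unique)
  also have "\<dots> \<le> integral {0..2*pi} (\<lambda>t. ?osc t + ((g (z + r * cis t) - a) - (U t - a)))"
  proof (rule integral_norm_bound_integral)
    show "(\<lambda>t. (U t - a) * cis (- t)) integrable_on {0..2*pi}" using D by blast
    show "(\<lambda>t. ?osc t + ((g (z + r * cis t) - a) - (U t - a))) integrable_on {0..2*pi}"
      by (intro integrable_continuous_interval continuous_intros cg cU)
    fix t
    have "U t \<le> g (z + r * cis t)" unfolding U_def by (rule le[OF mem])
    then show "cmod ((U t - a) * cis (- t)) \<le> ?osc t + ((g (z + r * cis t) - a) - (U t - a))"
      by (simp add: norm_mult flip: of_real_diff)
  qed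
  also have "\<dots> = integral {0..2*pi} ?osc + (integral {0..2*pi} (\<lambda>t. g (z + r * cis t) - a) - 0)"
  proof -
    have "((\<lambda>t. U t - a) has_integral 0) {0..2*pi}"
      using has_integral_diff[OF U has_integral_const_real[of a 0 "2*pi"]] by simp
    then show ?thesis
      by (intro integral_unique has_integral_add has_integral_diff integrable_integral iosc ig)
  qed
  also have "\<dots> \<le> 2 * integral {0..2*pi} ?osc"
    using integral_le[OF ig iosc] by simp
  finally have "cmod (deriv F z) \<le> 2 / (pi * r) * integral {0..2*pi} ?osc"
    using r by (simp add: field_simps)
  also have "\<dots> = cmod (complex_of_real (integral {0..2*pi} (\<lambda>t. 2 / (pi * r) * ?osc t)))"
    using r integral_nonneg[OF iosc] by (simp only: norm_of_real integral_mult_right) (simp add: abs_mult)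
  finally have "ennreal (cmod (deriv F z)) \<le> ennreal (cmod (complex_of_real (integral {0..2*pi} (\<lambda>t. 2 / (pi * r) * ?osc t))))"
    by (rule ennreal_leI)
  also have "\<dots> \<le> (\<integral>\<^sup>+t\<in>{0..2*pi}. ennreal (cmod (complex_of_real (2 / (pi * r) * ?osc t))) \<partial>lborel)"
  proof (rule norm_has_integral_le_nn_integral)
    show "((\<lambda>t. complex_of_real (2 / (pi * r) * ?osc t)) has_integral complex_of_real (integral {0..2*pi} (\<lambda>t. 2 / (pi * r) * ?osc t))) {0..2*pi}"
      by (intro has_integral_of_real integrable_integral integrable_on_mult_right iosc)
    show "continuous_on {0..2*pi} (\<lambda>t. complex_of_real (2 / (pi * r) * ?osc t))"
      by (intro continuous_intros cg)
  qed
  also have "\<dots> = (\<integral>\<^sup>+t\<in>{0..2*pi}. ennreal (2 / (pi * r) * ?osc t) \<partial>lborel)"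
    using r by (simp only: norm_of_real) (simp add: abs_mult)
  finally show ?thesis by (simp add: a_def)
qed

section \<open>Sub-mean-value inequality for powers of the modulus\<close>

lemma emeasure_ball_complex: "0 \<le> r \<Longrightarrow> emeasure lborel (ball (z::complex) r) = ennreal (pi * r\<^sup>2)"
  by (simp add: emeasure_ball unit_ball_vol_2)

lemma borel_measurable_cis [measurable]: "cis \<in> borel_measurable borel"
  by (intro borel_measurable_continuous_onI continuous_intros)

lemma circle_submean:
  assumes G: "G holomorphic_on ball z r" and \<zeta>: "\<zeta> \<in> ball z r"
  shows "ennreal (2 * pi * cmod (G z)) \<le> (\<integral>\<^sup>+t\<in>{0..2*pi}. ennreal (cmod (G (z + cis t * (\<zeta> - z)))) \<partial>lborel)"
proof -
  define F where "F w = G (z + w * (\<zeta> - z))" for w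
  have mem: "z + w * (\<zeta> - z) \<in> ball z r" if "w \<in> cball 0 1" for w
  proof -
    have "cmod w * cmod (\<zeta> - z) \<le> 1 * cmod (\<zeta> - z)"
      using that by (intro mult_right_mono) auto
    also have "\<dots> < r" using \<zeta> by (simp add: dist_norm norm_minus_commute)
    finally show ?thesis by (simp add: dist_norm norm_mult)
  qed
  have contG: "continuous_on (ball z r) G" using G holomorphic_on_imp_continuous_on by blast
  have cF: "continuous_on (cball 0 1) F" unfolding F_def
    by (rule continuous_on_compose2[OF contG]) (use mem in \<open>auto intro!: continuous_intros\<close>)
  have hF: "F holomorphic_on ball 0 1"
    unfolding F_def
    by (rule holomorphic_on_compose_gen[OF _ G, of "\<lambda>w. z + w * (\<zeta> - z)", unfolded o_def])
       (use mem in \<open>auto intro!: holomorphic_intros simp: less_imp_le\<close>)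
  have "((\<lambda>t. F (cis t)) has_integral 2 * pi * F 0) {0..2*pi}"
    using circle_mean_value[OF _ cF hF] by simp
  then have "ennreal (cmod (2 * pi * F 0)) \<le> (\<integral>\<^sup>+t\<in>{0..2*pi}. ennreal (cmod (F (cis t))) \<partial>lborel)"
    by (rule norm_has_integral_le_nn_integral)
       (auto intro!: continuous_on_compose2[OF cF] continuous_intros)
  then show ?thesis by (simp add: F_def norm_mult)
qed

lemma borel_measurable_norm_holomorphic:
  assumes "G holomorphic_on S" "open S"
  shows "(\<lambda>\<zeta>. cmod (indicator S \<zeta> *\<^sub>R G \<zeta>)) \<in> borel_measurable borel"
    and "(\<lambda>\<zeta>. ennreal (cmod (G \<zeta>) powr q) * indicator S \<zeta>) \<in> borel_measurable borel"
proof -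
  have [measurable]: "(\<lambda>\<zeta>. indicator S \<zeta> *\<^sub>R G \<zeta>) \<in> borel_measurable borel"
    using assms by (intro borel_measurable_continuous_on_indicator holomorphic_on_imp_continuous_on) auto
  show "(\<lambda>\<zeta>. cmod (indicator S \<zeta> *\<^sub>R G \<zeta>)) \<in> borel_measurable borel"
    by measurable
  have "(\<lambda>\<zeta>. ennreal (cmod (indicator S \<zeta> *\<^sub>R G \<zeta>) powr q)) \<in> borel_measurable borel"
    by measurable
  also have "(\<lambda>\<zeta>. ennreal (cmod (indicator S \<zeta> *\<^sub>R G \<zeta>) powr q)) = (\<lambda>\<zeta>. ennreal (cmod (G \<zeta>) powr q) * indicator S \<zeta>)"
    by (auto simp: fun_eq_iff indicator_def)
  finally show "(\<lambda>\<zeta>. ennreal (cmod (G \<zeta>) powr q) * indicator S \<zeta>) \<in> borel_measurable borel" .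
qed

text \<open>
  Average the circle inequality over all circles about \<open>z\<close> inside the disk. With Tonelli's theorem the
  rotation integral comes outside, and each rotated area integral equals the original one, so no polar
  coordinates are needed.
\<close>

lemma area_submean:
  assumes G: "G holomorphic_on ball z r"
  shows "emeasure lborel (ball z r) * ennreal (cmod (G z)) \<le> (\<integral>\<^sup>+\<zeta>\<in>ball z r. ennreal (cmod (G \<zeta>)) \<partial>lborel)"
proof -
  define H where "H \<zeta> = cmod (indicator (ball z r) \<zeta> *\<^sub>R G \<zeta>)" for \<zeta>
  have [measurable]: "H \<in> borel_measurable borel"
    unfolding H_def by (rule borel_measurable_norm_holomorphic(1)[OF G]) simp
  have H_in: "H \<zeta> = cmod (G \<zeta>)" if "\<zeta> \<in> ball z r" for \<zeta> using that by (simp add: H_def)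
  have H_out: "H \<zeta> = 0" if "\<zeta> \<notin> ball z r" for \<zeta> using that by (simp add: H_def)
  have rot: "z + cis t * (\<zeta> - z) \<in> ball z r \<longleftrightarrow> \<zeta> \<in> ball z r" for t \<zeta>
    by (simp add: dist_norm norm_mult norm_minus_commute)
  have "ennreal (2 * pi) * (emeasure lborel (ball z r) * ennreal (cmod (G z)))
      = (\<integral>\<^sup>+\<zeta>\<in>ball z r. ennreal (2 * pi * cmod (G z)) \<partial>lborel)"
    by (subst nn_integral_cmult_indicator) (auto simp: ennreal_mult mult_ac)
  also have "\<dots> \<le> (\<integral>\<^sup>+\<zeta>. (\<integral>\<^sup>+t\<in>{0..2*pi}. ennreal (H (z + cis t * (\<zeta> - z))) \<partial>lborel) \<partial>lborel)"
  proof (rule nn_integral_mono)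
    fix \<zeta> :: complex
    show "ennreal (2 * pi * cmod (G z)) * indicator (ball z r) \<zeta>
      \<le> (\<integral>\<^sup>+t\<in>{0..2*pi}. ennreal (H (z + cis t * (\<zeta> - z))) \<partial>lborel)"
    proof (cases "\<zeta> \<in> ball z r")
      case True
      then show ?thesis using circle_submean[OF G True] by (simp add: H_in[OF rot[THEN iffD2]])
    qed simp
  qed
  also have "\<dots> = (\<integral>\<^sup>+t. (\<integral>\<^sup>+\<zeta>. ennreal (H (z + cis t * (\<zeta> - z))) * indicator {0..2*pi} t \<partial>lborel) \<partial>lborel)"
    by (rule lborel_pair.Fubini') (auto simp: case_prod_beta')
  also have "\<dots> = (\<integral>\<^sup>+t. (\<integral>\<^sup>+\<zeta>. ennreal (H \<zeta>) \<partial>lborel) * indicator {0..2*pi} t \<partial>lborel)"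
  proof (intro nn_integral_cong)
    fix t :: real
    have "(\<integral>\<^sup>+\<zeta>. ennreal (H (z + cis t * (\<zeta> - z))) * indicator {0..2*pi} t \<partial>lborel)
        = (\<integral>\<^sup>+\<zeta>. ennreal (H (z + cis t * (\<zeta> - z))) \<partial>lborel) * indicator {0..2*pi} t"
      by (rule nn_integral_multc) measurable
    also have "(\<integral>\<^sup>+\<zeta>. ennreal (H (z + cis t * (\<zeta> - z))) \<partial>lborel) = (\<integral>\<^sup>+\<zeta>. ennreal (H \<zeta>) \<partial>lborel)"
      by (rule nn_integral_rotate_about) auto
    finally show "(\<integral>\<^sup>+\<zeta>. ennreal (H (z + cis t * (\<zeta> - z))) * indicator {0..2*pi} t \<partial>lborel)
        = (\<integral>\<^sup>+\<zeta>. ennreal (H \<zeta>) \<partial>lborel) * indicator {0..2*pi} t" .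
  qed
  also have "\<dots> = ennreal (2 * pi) * (\<integral>\<^sup>+\<zeta>. ennreal (H \<zeta>) \<partial>lborel)"
    by (simp add: nn_integral_cmult_indicator mult.commute)
  also have "(\<integral>\<^sup>+\<zeta>. ennreal (H \<zeta>) \<partial>lborel) = (\<integral>\<^sup>+\<zeta>\<in>ball z r. ennreal (cmod (G \<zeta>)) \<partial>lborel)"
    by (intro nn_integral_cong) (simp add: H_def indicator_def)
  finally have "ennreal (2 * pi) * (emeasure lborel (ball z r) * ennreal (cmod (G z)))
      \<le> ennreal (2 * pi) * (\<integral>\<^sup>+\<zeta>\<in>ball z r. ennreal (cmod (G \<zeta>)) \<partial>lborel)" .
  moreover have "ennreal (2 * pi) \<noteq> 0" "ennreal (2 * pi) \<noteq> top" by (auto simp: ennreal_eq_0_iff not_le)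
  ultimately show ?thesis using ennreal_mult_le_mult_iff by blast
qed

text \<open>
  Jensen's inequality for the area mean, through the tangent line at \<open>cmod (G z)\<close>.
\<close>

lemma power_submean_ge_1:
  assumes r: "0 < r" and G: "G holomorphic_on ball z r" and q: "1 \<le> q"
  shows "ennreal (pi * r\<^sup>2 * cmod (G z) powr q) \<le> (\<integral>\<^sup>+\<zeta>\<in>ball z r. ennreal (cmod (G \<zeta>) powr q) \<partial>lborel)"
proof -
  let ?B = "ball z r"
  define c where "c = cmod (G z)"
  have c: "c \<ge> 0" by (simp add: c_def)
  have m1: "(\<lambda>\<zeta>. ennreal (cmod (G \<zeta>)) * indicator ?B \<zeta>) \<in> borel_measurable lborel"
    using borel_measurable_norm_holomorphic(2)[OF G open_ball, where q = 1] by simp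
  have mq: "(\<lambda>\<zeta>. ennreal (cmod (G \<zeta>) powr q) * indicator ?B \<zeta>) \<in> borel_measurable lborel"
    using borel_measurable_norm_holomorphic(2)[OF G open_ball, where q = q] by simp
  have m0: "(\<lambda>\<zeta>. ennreal ((q - 1) * c powr q) * indicator ?B \<zeta>) \<in> borel_measurable lborel"
    by (intro borel_measurable_times_ennreal borel_measurable_const borel_measurable_indicator) simp
  have "ennreal (pi * r\<^sup>2 * c powr q) + ennreal ((q - 1) * c powr q * (pi * r\<^sup>2)) = ennreal (q * c powr (q - 1)) * (ennreal (pi * r\<^sup>2) * ennreal c)"
  proof -
    have "pi * r\<^sup>2 * c powr q + (q - 1) * c powr q * (pi * r\<^sup>2) = q * c powr (q - 1) * (pi * r\<^sup>2 * c)"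
      using c q by (cases "c = 0") (auto simp: powr_diff field_simps)
    then show ?thesis using c q by (simp flip: ennreal_mult ennreal_plus)
  qed
  also have "\<dots> \<le> ennreal (q * c powr (q - 1)) * (\<integral>\<^sup>+\<zeta>\<in>?B. ennreal (cmod (G \<zeta>)) \<partial>lborel)"
    using area_submean[OF G] r by (intro mult_left_mono) (auto simp: emeasure_ball_complex c_def)
  also have "\<dots> = (\<integral>\<^sup>+\<zeta>. ennreal (q * c powr (q - 1)) * (ennreal (cmod (G \<zeta>)) * indicator ?B \<zeta>) \<partial>lborel)"
    by (rule nn_integral_cmult[OF m1, symmetric])
  also have "\<dots> \<le> (\<integral>\<^sup>+\<zeta>. ennreal (cmod (G \<zeta>) powr q) * indicator ?B \<zeta> + ennreal ((q - 1) * c powr q) * indicator ?B \<zeta> \<partial>lborel)"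
  proof (rule nn_integral_mono)
    fix \<zeta>
    show "ennreal (q * c powr (q - 1)) * (ennreal (cmod (G \<zeta>)) * indicator ?B \<zeta>)
      \<le> ennreal (cmod (G \<zeta>) powr q) * indicator ?B \<zeta> + ennreal ((q - 1) * c powr q) * indicator ?B \<zeta>"
      using Youngs_powr[OF q, of "cmod (G \<zeta>)" c] c q
      by (auto simp: indicator_def mult.assoc simp flip: ennreal_mult ennreal_plus intro!: ennreal_leI)
  qed
  also have "\<dots> = (\<integral>\<^sup>+\<zeta>\<in>?B. ennreal (cmod (G \<zeta>) powr q) \<partial>lborel) + ennreal ((q - 1) * c powr q * (pi * r\<^sup>2))"
  proof -
    have "(\<integral>\<^sup>+\<zeta>. ennreal ((q - 1) * c powr q) * indicator ?B \<zeta> \<partial>lborel) = ennreal ((q - 1) * c powr q * (pi * r\<^sup>2))"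
      using q r by (subst nn_integral_cmult_indicator) (simp_all add: emeasure_ball_complex flip: ennreal_mult)
    then show ?thesis by (simp only: nn_integral_add[OF mq m0])
  qed
  finally show ?thesis unfolding c_def
    by (simp add: ennreal_add_left_cancel_le add.commute)
qed

text \<open>
  Jensen's inequality fails for \<open>q < 1\<close>; a maximum argument in the manner of Hardy and Littlewood
  replaces it. Choose \<open>w\<close> where the weighted modulus \<open>(r - |z - \<zeta>|)\<^sup>2\<^sup>/\<^sup>q |G \<zeta>|\<close> is largest, and
  let \<open>s\<close> be the distance of \<open>w\<close> from the circle. On the disk of radius \<open>s / 2\<close> about \<open>w\<close> the values
  of \<open>|G|\<close> are at most a constant times \<open>|G w|\<close>, so there \<open>|G|\<close> is at most a constant times
  \<open>|G w|\<^sup>1\<^sup>-\<^sup>q |G|\<^sup>q\<close>, and the case of exponent 1 at \<open>w\<close> gives the estimate at \<open>w\<close>. By the choice of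
  \<open>w\<close> it carries over to \<open>z\<close>.
\<close>

lemma power_submean_less_1:
  assumes r: "0 < r" and cont: "continuous_on (cball z r) G" and G: "G holomorphic_on ball z r" and q: "0 < q" "q < 1"
  shows "ennreal (pi * r\<^sup>2 * cmod (G z) powr q)
    \<le> ennreal (4 * 2 powr (2 * (1 - q) / q)) * (\<integral>\<^sup>+\<zeta>\<in>ball z r. ennreal (cmod (G \<zeta>) powr q) \<partial>lborel)"
proof (cases "G z = 0")
  case False
  \<comment> \<open>The weight vanishes on the circle, so the maximum lies inside; its exponent makes \<open>\<phi>\<^sup>q\<close> scale like the area.\<close>
  define \<phi> where "\<phi> \<zeta> = (r - dist z \<zeta>) powr (2/q) * cmod (G \<zeta>)" for \<zeta>
  have "continuous_on (cball z r) \<phi>"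
    unfolding \<phi>_def using q by (intro continuous_intros continuous_on_powr' cont) auto
  then obtain w where w: "w \<in> cball z r" "\<And>\<zeta>. \<zeta> \<in> cball z r \<Longrightarrow> \<phi> \<zeta> \<le> \<phi> w"
    using continuous_attains_sup[of "cball z r" \<phi>] r by auto
  have "0 < \<phi> z" using False r by (simp add: \<phi>_def)
  also have wz: "\<phi> z \<le> \<phi> w" using w(2)[of z] r by simp
  finally have \<phi>w: "\<phi> w > 0" .
  define s where "s = r - dist z w"
  have s: "s > 0" and Gw: "cmod (G w) > 0"
    using \<phi>w w(1) by (auto simp: \<phi>_def s_def less_le zero_less_mult_iff)
  have sub: "ball w (s/2) \<subseteq> ball z r"
  proof
    fix \<zeta> assume "\<zeta> \<in> ball w (s/2)"
    then show "\<zeta> \<in> ball z r" using dist_triangle[of z \<zeta> w] s by (simp add: s_def)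
  qed
  have bd: "cmod (G \<zeta>) \<le> 2 powr (2/q) * cmod (G w)" if "\<zeta> \<in> ball w (s/2)" for \<zeta>
  proof -
    have "s / 2 \<le> r - dist z \<zeta>" using that dist_triangle[of z \<zeta> w] s by (simp add: s_def field_simps)
    then have "(s/2) powr (2/q) * cmod (G \<zeta>) \<le> \<phi> \<zeta>"
      unfolding \<phi>_def using s q by (intro mult_right_mono powr_mono2) auto
    also have "\<dots> \<le> \<phi> w" using that sub by (intro w(2)) (auto simp: less_imp_le subset_iff)
    also have "\<dots> = s powr (2/q) * cmod (G w)" by (simp add: \<phi>_def s_def)
    finally show ?thesis using s by (simp add: powr_divide field_simps)
  qed
  define A where "A = (2 powr (2/q) * cmod (G w)) powr (1 - q)"
  have A: "A > 0" using Gw by (simp add: A_def)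
  have "ennreal (pi * (s/2)\<^sup>2 * cmod (G w)) \<le> (\<integral>\<^sup>+\<zeta>\<in>ball w (s/2). ennreal (cmod (G \<zeta>)) \<partial>lborel)"
    using area_submean[OF holomorphic_on_subset[OF G sub]] s
    by (simp add: emeasure_ball_complex ennreal_mult)
  also have "\<dots> \<le> (\<integral>\<^sup>+\<zeta>. ennreal A * (ennreal (cmod (G \<zeta>) powr q) * indicator (ball z r) \<zeta>) \<partial>lborel)"
  proof (rule nn_integral_mono)
    fix \<zeta>
    show "ennreal (cmod (G \<zeta>)) * indicator (ball w (s/2)) \<zeta> \<le> ennreal A * (ennreal (cmod (G \<zeta>) powr q) * indicator (ball z r) \<zeta>)"
    proof (cases "\<zeta> \<in> ball w (s/2)")
      case True
      have "cmod (G \<zeta>) = cmod (G \<zeta>) powr (1 - q) * cmod (G \<zeta>) powr q"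
        by (simp flip: powr_add)
      also have "\<dots> \<le> A * cmod (G \<zeta>) powr q"
        unfolding A_def using q bd[OF True] by (intro mult_right_mono powr_mono2) auto
      finally show ?thesis using True sub A by (auto simp flip: ennreal_mult intro!: ennreal_leI)
    qed simp
  qed
  also have "\<dots> = ennreal A * (\<integral>\<^sup>+\<zeta>\<in>ball z r. ennreal (cmod (G \<zeta>) powr q) \<partial>lborel)"
    using borel_measurable_norm_holomorphic(2)[OF G, of q] by (simp add: nn_integral_cmult)
  finally have *: "ennreal (pi * (s/2)\<^sup>2 * cmod (G w)) \<le> ennreal A * (\<integral>\<^sup>+\<zeta>\<in>ball z r. ennreal (cmod (G \<zeta>) powr q) \<partial>lborel)" .
  have "pi * r\<^sup>2 * cmod (G z) powr q = pi * \<phi> z powr q"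
    using r q by (simp add: \<phi>_def powr_mult powr_powr)
  also have "\<dots> \<le> pi * \<phi> w powr q" using wz \<open>0 < \<phi> z\<close> q by (intro mult_left_mono powr_mono2) auto
  also have "\<dots> = pi * s\<^sup>2 * cmod (G w) powr q"
    using s q by (simp add: \<phi>_def powr_mult powr_powr flip: s_def)
  also have "\<dots> = 4 * cmod (G w) powr (q - 1) * (pi * (s/2)\<^sup>2 * cmod (G w))"
    using Gw by (simp add: powr_diff power_divide)
  finally have "ennreal (pi * r\<^sup>2 * cmod (G z) powr q) \<le> ennreal (4 * cmod (G w) powr (q - 1)) * ennreal (pi * (s/2)\<^sup>2 * cmod (G w))"
    by (simp flip: ennreal_mult add: ennreal_leI)
  also have "\<dots> \<le> ennreal (4 * cmod (G w) powr (q - 1)) * (ennreal A * (\<integral>\<^sup>+\<zeta>\<in>ball z r. ennreal (cmod (G \<zeta>) powr q) \<partial>lborel))"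
    by (intro mult_left_mono *) auto
  also have "\<dots> = ennreal (4 * cmod (G w) powr (q - 1) * A) * (\<integral>\<^sup>+\<zeta>\<in>ball z r. ennreal (cmod (G \<zeta>) powr q) \<partial>lborel)"
    using A by (simp add: ennreal_mult mult.assoc)
  also have "4 * cmod (G w) powr (q - 1) * A = 4 * 2 powr (2 * (1 - q) / q)"
  proof -
    have "A = 2 powr (2 * (1 - q) / q) * cmod (G w) powr (1 - q)"
      using Gw by (simp add: A_def powr_mult powr_powr)
    moreover have "cmod (G w) powr (q - 1) * cmod (G w) powr (1 - q) = 1"
      using Gw by (simp flip: powr_add)
    ultimately show ?thesis by simp
  qed
  finally show ?thesis .
qed (use q in simp)

lemma power_submean:
  assumes q: "0 < q"
  obtains C where "0 < C" "\<And>G z r. 0 < r \<Longrightarrow> continuous_on (cball z r) G \<Longrightarrow> G holomorphic_on ball z r \<Longrightarrow>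
    ennreal (pi * r\<^sup>2 * cmod (G z) powr q) \<le> ennreal C * (\<integral>\<^sup>+\<zeta>\<in>ball z r. ennreal (cmod (G \<zeta>) powr q) \<partial>lborel)"
proof (cases "1 \<le> q")
  case True
  show ?thesis using power_submean_ge_1[OF _ _ True] by (intro that[of 1]) simp_all
next
  case False
  then show ?thesis using power_submean_less_1[OF _ _ _ q] by (intro that[of "4 * 2 powr (2 * (1 - q) / q)"]) simp_all
qed

section \<open>Bounds for p-means over rotations\<close>

text \<open>
  A bound for the \<open>L\<^sup>p\<close> norm in the rotation parameter. For \<open>p = \<infinity>\<close> it is the bound at the rotation
  \<open>\<eta> = 0\<close>, in accordance with the pointwise convention for \<open>\<Lambda>\<close> and the means. Stated for \<open>p\<close>-th powers
  of real numbers, it needs no roots and treats both cases alike.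
\<close>

definition rot_bound :: "ennreal \<Rightarrow> (real \<Rightarrow> real) \<Rightarrow> real \<Rightarrow> bool" where
  "rot_bound p g c \<longleftrightarrow>
     (if p = \<infinity> then g 0 \<le> c
      else (\<integral>\<^sup>+\<eta>\<in>{0..2*pi}. ennreal (g \<eta> powr enn2real p) \<partial>lborel) \<le> ennreal (c powr enn2real p))"

lemma enn2real_exponent_ge_1: "1 \<le> p \<Longrightarrow> p \<noteq> \<infinity> \<Longrightarrow> 1 \<le> enn2real p"
  by (cases p rule: ennreal_cases) (auto simp flip: ennreal_1)

lemma ennreal_powr_inverse_le_iff:
  assumes "0 < a" "0 \<le> c"
  shows "ennreal_powr x (1 / a) \<le> ennreal c \<longleftrightarrow> x \<le> ennreal (c powr a)"
proof (cases x rule: ennreal_cases)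
  case (real r)
  have "r powr (1 / a) \<le> c \<longleftrightarrow> r \<le> c powr a"
  proof
    assume "r powr (1 / a) \<le> c"
    then have "(r powr (1 / a)) powr a \<le> c powr a" using assms by (intro powr_mono2) auto
    then show "r \<le> c powr a" using assms real by (simp add: powr_powr)
  next
    assume "r \<le> c powr a"
    then have "r powr (1 / a) \<le> (c powr a) powr (1 / a)" using assms real by (intro powr_mono2) auto
    then show "r powr (1 / a) \<le> c" using assms by (simp add: powr_powr)
  qed
  then show ?thesis using real assms by (simp add: ennreal_powr_def)
qed (simp add: ennreal_powr_def top_unique)

lemma circle_mean_le_iff:
  assumes "1 \<le> p" "0 \<le> c"
  shows "circle_mean p F z \<le> ennreal c \<longleftrightarrow> rot_bound p (\<lambda>\<eta>. cmod (F (z * cis \<eta>))) c"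
proof (cases "p = \<infinity>")
  case False
  then have "0 < enn2real p" using enn2real_exponent_ge_1[OF assms(1)] by simp
  then show ?thesis using assms False
    by (simp add: circle_mean_def rot_bound_def ennreal_powr_inverse_le_iff)
qed (use assms in \<open>simp add: circle_mean_def rot_bound_def\<close>)

lemma Lp_diff_le_iff:
  assumes "1 \<le> p" "0 \<le> c"
  shows "Lp_diff p F z\<^sub>1 z\<^sub>2 \<le> ennreal c \<longleftrightarrow> rot_bound p (\<lambda>\<eta>. cmod (F (cis \<eta> * z\<^sub>1) - F (cis \<eta> * z\<^sub>2))) c"
proof (cases "p = \<infinity>")
  case False
  then have "0 < enn2real p" using enn2real_exponent_ge_1[OF assms(1)] by simp
  then show ?thesis using assms False
    by (simp add: Lp_diff_def rot_bound_def ennreal_powr_inverse_le_iff)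
qed (use assms in \<open>simp add: Lp_diff_def rot_bound_def\<close>)

lemma rot_bound_mono:
  assumes "rot_bound p g c" "\<And>\<eta>. 0 \<le> g' \<eta>" "\<And>\<eta>. g' \<eta> \<le> g \<eta>" "c \<le> c'" "0 \<le> c"
  shows "rot_bound p g' c'"
proof (cases "p = \<infinity>")
  case True
  then show ?thesis using assms(1,4) assms(3)[of 0] by (simp add: rot_bound_def)
next
  case False
  have "(\<integral>\<^sup>+\<eta>\<in>{0..2*pi}. ennreal (g' \<eta> powr enn2real p) \<partial>lborel)
      \<le> (\<integral>\<^sup>+\<eta>\<in>{0..2*pi}. ennreal (g \<eta> powr enn2real p) \<partial>lborel)"
    using assms(2,3) by (intro nn_integral_mono mult_right_mono ennreal_leI powr_mono2) auto
  also have "\<dots> \<le> ennreal (c powr enn2real p)" using assms(1) False by (simp add: rot_bound_def)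
  also have "\<dots> \<le> ennreal (c' powr enn2real p)"
    using assms(4,5) by (intro ennreal_leI powr_mono2) auto
  finally show ?thesis using False by (simp add: rot_bound_def)
qed

lemma rot_bound_scale:
  assumes "rot_bound p g c" "g \<in> borel_measurable borel" "\<And>\<eta>. 0 \<le> g \<eta>" "0 \<le> c" "0 \<le> k"
  shows "rot_bound p (\<lambda>\<eta>. k * g \<eta>) (k * c)"
proof (cases "p = \<infinity>")
  case True
  then show ?thesis using assms by (simp add: rot_bound_def mult_left_mono)
next
  case False
  have [measurable]: "g \<in> borel_measurable borel" by fact
  have "(\<integral>\<^sup>+\<eta>\<in>{0..2*pi}. ennreal ((k * g \<eta>) powr enn2real p) \<partial>lborel)
      = (\<integral>\<^sup>+\<eta>. ennreal (k powr enn2real p) * (ennreal (g \<eta> powr enn2real p) * indicator {0..2*pi} \<eta>) \<partial>lborel)"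
    using assms by (intro nn_integral_cong) (simp add: powr_mult ennreal_mult mult.assoc)
  also have "\<dots> = ennreal (k powr enn2real p) * (\<integral>\<^sup>+\<eta>\<in>{0..2*pi}. ennreal (g \<eta> powr enn2real p) \<partial>lborel)"
    by (rule nn_integral_cmult) simp
  also have "\<dots> \<le> ennreal (k powr enn2real p) * ennreal (c powr enn2real p)"
    using assms(1) False by (intro mult_left_mono) (auto simp: rot_bound_def)
  also have "\<dots> = ennreal ((k * c) powr enn2real p)"
    using assms by (simp add: powr_mult ennreal_mult)
  finally show ?thesis using False by (simp add: rot_bound_def)
qed

text \<open>
  Replaces the exponent \<open>p\<close> by \<open>p / q\<close>. For \<open>p = \<infinity>\<close> the quotient is again \<open>\<infinity>\<close>.
\<close>

lemma rot_bound_powr_iff: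
  assumes "0 < q" "0 < p" "\<And>\<eta>. 0 \<le> g \<eta>" "0 \<le> c"
  shows "rot_bound (p / ennreal q) (\<lambda>\<eta>. g \<eta> powr q) (c powr q) \<longleftrightarrow> rot_bound p g c"
proof (cases p rule: ennreal_cases)
  case (real r)
  have "p / ennreal q = ennreal (r / q)" "enn2real p = r"
    using real assms by (auto simp: divide_ennreal)
  then show ?thesis using assms real by (simp add: rot_bound_def powr_powr)
next
  case top
  have "g 0 powr q \<le> c powr q \<longleftrightarrow> g 0 \<le> c"
    using assms by (metis linorder_not_le powr_less_mono2 powr_mono2 less_imp_le)
  then show ?thesis using top by (simp add: rot_bound_def ennreal_top_divide)
qed

text \<open>
  Fatou's lemma.
\<close>

lemma rot_bound_limit:
  assumes b: "\<And>n::nat. rot_bound p (g n) c" and m: "\<And>n. g n \<in> borel_measurable borel"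
    and g0: "\<And>n \<eta>. 0 \<le> g n \<eta>" and lim: "\<And>\<eta>. (\<lambda>n. g n \<eta>) \<longlonglongrightarrow> G \<eta>" and p: "1 \<le> p"
  shows "rot_bound p G c"
proof (cases "p = \<infinity>")
  case True
  then have "\<And>n. g n 0 \<le> c" using b by (simp add: rot_bound_def)
  then have "G 0 \<le> c" using lim[of 0] by (intro LIMSEQ_le_const2) auto
  then show ?thesis using True by (simp add: rot_bound_def)
next
  case False
  define P where "P = enn2real p"
  have P: "P > 0" using enn2real_exponent_ge_1[OF p False] by (simp add: P_def)
  have [measurable]: "g n \<in> borel_measurable borel" for n by (rule m)
  have G0: "0 \<le> G \<eta>" for \<eta> using lim[of \<eta>] g0 by (intro LIMSEQ_le_const) auto
  have lim': "(\<lambda>n. ennreal (g n \<eta> powr P) * indicator {0..2*pi} \<eta>) \<longlonglongrightarrow> ennreal (G \<eta> powr P) * indicator {0..2*pi} \<eta>" for \<eta>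
  proof (cases "\<eta> \<in> {0..2*pi}")
    case True
    have "(\<lambda>n. ennreal (g n \<eta> powr P)) \<longlonglongrightarrow> ennreal (G \<eta> powr P)"
      using P G0 g0 lim by (intro tendsto_ennrealI tendsto_powr2) auto
    then show ?thesis using True by simp
  qed simp
  have "(\<integral>\<^sup>+\<eta>\<in>{0..2*pi}. ennreal (G \<eta> powr P) \<partial>lborel)
      = (\<integral>\<^sup>+\<eta>. liminf (\<lambda>n. ennreal (g n \<eta> powr P) * indicator {0..2*pi} \<eta>) \<partial>lborel)"
    by (intro nn_integral_cong lim_imp_Liminf[symmetric] lim') simp
  also have "\<dots> \<le> liminf (\<lambda>n. \<integral>\<^sup>+\<eta>\<in>{0..2*pi}. ennreal (g n \<eta> powr P) \<partial>lborel)"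
    by (intro nn_integral_liminf) simp
  also have "\<dots> \<le> liminf (\<lambda>n. ennreal (c powr P))"
    using b False by (intro Liminf_mono always_eventually) (simp add: rot_bound_def P_def)
  also have "\<dots> = ennreal (c powr P)" by (simp add: Liminf_const)
  finally show ?thesis using False by (simp add: rot_bound_def P_def)
qed

lemma rot_bound_Minkowski:
  fixes h :: "'a \<Rightarrow> real \<Rightarrow> real"
  assumes M: "finite_measure M" and p: "1 \<le> p"
    and h: "(\<lambda>(t, \<eta>). h t \<eta>) \<in> borel_measurable (M \<Otimes>\<^sub>M lborel)"
    and h0: "\<And>t \<eta>. 0 \<le> h t \<eta>"
    and k: "k \<in> borel_measurable M" and k0: "\<And>t. t \<in> space M \<Longrightarrow> 0 \<le> k t"
    and hk: "\<And>t. t \<in> space M \<Longrightarrow> rot_bound p (h t) (k t)"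
    and S: "(\<integral>\<^sup>+t. ennreal (k t) \<partial>M) \<le> ennreal S" "0 \<le> S"
    and G: "\<And>\<eta>. 0 \<le> G \<eta>" "\<And>\<eta>. ennreal (G \<eta>) \<le> (\<integral>\<^sup>+t. ennreal (h t \<eta>) \<partial>M)"
  shows "rot_bound p G S"
proof (cases "p = \<infinity>")
  case True
  have "ennreal (G 0) \<le> (\<integral>\<^sup>+t. ennreal (h t 0) \<partial>M)" by (rule G)
  also have "\<dots> \<le> (\<integral>\<^sup>+t. ennreal (k t) \<partial>M)"
    using hk True by (intro nn_integral_mono ennreal_leI) (simp add: rot_bound_def)
  also note S(1)
  finally show ?thesis using True S(2) by (simp add: rot_bound_def)
next
  case False
  define N where "N = restrict_space lborel {0..2*pi}"
  have N: "sigma_finite_measure N" unfolding N_def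
    by (intro finite_measure.axioms(1) finite_measureI) (simp add: space_restrict_space emeasure_restrict_space)
  have conv: "(\<integral>\<^sup>+\<eta>. F \<eta> \<partial>N) = (\<integral>\<^sup>+\<eta>\<in>{0..2*pi}. F \<eta> \<partial>lborel)" for F :: "real \<Rightarrow> ennreal"
    unfolding N_def by (rule nn_integral_restrict_space) simp
  have id: "(\<lambda>x. (fst x, snd x)) \<in> (M \<Otimes>\<^sub>M N) \<rightarrow>\<^sub>M (M \<Otimes>\<^sub>M lborel)"
    unfolding N_def by (intro measurable_Pair measurable_fst measurable_compose[OF measurable_snd] measurable_restrict_space1) simp
  have hN: "(\<lambda>(t, \<eta>). h t \<eta>) \<in> borel_measurable (M \<Otimes>\<^sub>M N)"
    using measurable_compose[OF id h] by (simp add: case_prod_beta')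
  have "(\<integral>\<^sup>+\<eta>. ennreal (G \<eta> powr enn2real p) \<partial>N) \<le> ennreal (S powr enn2real p)"
    using hk False
    by (intro Minkowski_integral[OF M N enn2real_exponent_ge_1[OF p False] hN h0 k k0 _ S G])
       (auto simp: rot_bound_def conv)
  then show ?thesis using False by (simp add: rot_bound_def conv)
qed

lemma rot_bound_set_Minkowski:
  fixes h :: "'a::euclidean_space \<Rightarrow> real \<Rightarrow> real"
  assumes A: "A \<in> sets borel" "emeasure lborel A \<noteq> \<infinity>" and p: "1 \<le> p"
    and h: "(\<lambda>(t, \<eta>). h t \<eta>) \<in> borel_measurable (borel \<Otimes>\<^sub>M borel)"
    and h0: "\<And>t \<eta>. 0 \<le> h t \<eta>"
    and k: "k \<in> borel_measurable borel" and k0: "\<And>t. t \<in> A \<Longrightarrow> 0 \<le> k t"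
    and hk: "\<And>t. t \<in> A \<Longrightarrow> rot_bound p (h t) (k t)"
    and S: "(\<integral>\<^sup>+t\<in>A. ennreal (k t) \<partial>lborel) \<le> ennreal S" "0 \<le> S"
    and G: "\<And>\<eta>. 0 \<le> G \<eta>" "\<And>\<eta>. ennreal (G \<eta>) \<le> (\<integral>\<^sup>+t\<in>A. ennreal (h t \<eta>) \<partial>lborel)"
  shows "rot_bound p G S"
proof (rule rot_bound_Minkowski[where M = "restrict_space lborel A"])
  have conv: "(\<integral>\<^sup>+t. F t \<partial>restrict_space lborel A) = (\<integral>\<^sup>+t\<in>A. F t \<partial>lborel)" for F :: "'a \<Rightarrow> ennreal"
    using A by (intro nn_integral_restrict_space) simp
  show "finite_measure (restrict_space lborel A)"
    using A by (intro finite_measureI) (simp add: space_restrict_space emeasure_restrict_space)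
  have "(\<lambda>x. (fst x, snd x)) \<in> (restrict_space lborel A \<Otimes>\<^sub>M lborel) \<rightarrow>\<^sub>M (borel \<Otimes>\<^sub>M borel)"
    by (intro measurable_Pair measurable_compose[OF measurable_fst] measurable_compose[OF measurable_snd] measurable_restrict_space1) auto
  from measurable_compose[OF this h]
  show "(\<lambda>(t, \<eta>). h t \<eta>) \<in> borel_measurable (restrict_space lborel A \<Otimes>\<^sub>M lborel)"
    by (simp add: case_prod_beta')
  show "k \<in> borel_measurable (restrict_space lborel A)"
    using k by (intro measurable_restrict_space1) simp
qed (use A assms in \<open>simp_all add: space_restrict_space nn_integral_restrict_space\<close>)

text \<open>
  The triangle inequality is Minkowski's integral inequality for the counting measure on two points.
\<close>

lemma rot_bound_add:
  assumes p: "1 \<le> p" and b: "rot_bound p g1 c1" "rot_bound p g2 c2" and c: "0 \<le> c1" "0 \<le> c2"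
    and m: "g1 \<in> borel_measurable borel" "g2 \<in> borel_measurable borel"
    and g: "\<And>\<eta>. 0 \<le> g1 \<eta>" "\<And>\<eta>. 0 \<le> g2 \<eta>" "\<And>\<eta>. 0 \<le> G \<eta>" "\<And>\<eta>. G \<eta> \<le> g1 \<eta> + g2 \<eta>"
  shows "rot_bound p G (c1 + c2)"
proof (rule rot_bound_Minkowski[where M = "count_space (UNIV :: bool set)"
      and h = "\<lambda>b. if b then g1 else g2" and k = "\<lambda>b. if b then c1 else c2"])
  show "finite_measure (count_space (UNIV :: bool set))" by (rule finite_measure_count_space) simp
  show "(\<lambda>(b, \<eta>). (if b then g1 else g2) \<eta>) \<in> borel_measurable (count_space UNIV \<Otimes>\<^sub>M lborel)"
    using m by (intro measurable_pair_measure_countable1) auto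
  show "ennreal (G \<eta>) \<le> (\<integral>\<^sup>+b. ennreal ((if b then g1 else g2) \<eta>) \<partial>count_space UNIV)" for \<eta>
    using g[of \<eta>] by (simp add: nn_integral_count_space_finite UNIV_bool add.commute ennreal_leI flip: ennreal_plus)
  show "(\<integral>\<^sup>+b. ennreal (if b then c1 else c2) \<partial>count_space UNIV) \<le> ennreal (c1 + c2)"
    using c by (simp add: nn_integral_count_space_finite UNIV_bool add.commute)
qed (use assms in auto)

section \<open>The Hardy-Littlewood argument: growth of the derivative bounds differences\<close>

lemma majorantD:
  assumes "majorant \<omega>"
  shows "continuous_on {0..} \<omega>" "\<And>s t. 0 \<le> s \<Longrightarrow> s \<le> t \<Longrightarrow> \<omega> s \<le> \<omega> t" "\<And>t. 0 \<le> t \<Longrightarrow> 0 \<le> \<omega> t"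
    "\<omega> 0 = 0" "\<And>s t. 0 < s \<Longrightarrow> s \<le> t \<Longrightarrow> \<omega> t / t \<le> \<omega> s / s"
  using assms unfolding majorant_def by (auto simp: mono_on_def monotone_on_def)

text \<open>
  The defining inequality of a fast majorant, given for small \<open>s\<close>, extends to all \<open>s \<le> 1\<close>: beyond
  \<open>e = \<delta> / 2\<close> the integrand is at most \<open>\<omega> e / e\<close>.
\<close>

lemma fast_majorant_integral:
  assumes "fast_majorant \<omega>"
  obtains C where "0 < C"
    "\<And>s. 0 < s \<Longrightarrow> s \<le> 1 \<Longrightarrow> (\<integral>\<^sup>+t\<in>{0<..<s}. ennreal (\<omega> t / t) \<partial>lborel) \<le> ennreal (C * \<omega> s)"
proof -
  have maj: "majorant \<omega>" using assms by (simp add: fast_majorant_def)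
  note w = majorantD[OF maj]
  obtain \<delta> M where \<delta>: "\<delta> > 0" "M > 0"
    and M: "\<And>s. 0 < s \<Longrightarrow> s < \<delta> \<Longrightarrow> (\<integral>\<^sup>+t\<in>{0<..<s}. ennreal (\<omega> t / t) \<partial>lborel) \<le> ennreal (M * \<omega> s)"
    using assms unfolding fast_majorant_def by blast
  define e where "e = \<delta> / 2"
  have e: "0 < e" "e < \<delta>" using \<delta> by (auto simp: e_def)
  show ?thesis
  proof (rule that[of "M + 1 / e"])
    show "0 < M + 1 / e" using \<delta> e by (simp add: add_pos_pos)
    fix s :: real assume s: "0 < s" "s \<le> 1"
    show "(\<integral>\<^sup>+t\<in>{0<..<s}. ennreal (\<omega> t / t) \<partial>lborel) \<le> ennreal ((M + 1 / e) * \<omega> s)"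
    proof (cases "s < \<delta>")
      case True
      have "M * \<omega> s \<le> (M + 1 / e) * \<omega> s"
        using e w(3)[of s] s by (intro mult_right_mono) auto
      then show ?thesis using M[OF s(1) True] by (meson ennreal_leI order_trans)
    next
      case False
      have es: "e \<le> s" using False e by simp
      have me: "(\<lambda>t. ennreal (\<omega> t / t) * indicator {0<..<e} t) \<in> borel_measurable lborel"
      proof -
        have "(\<lambda>t. indicator {0<..<e} t *\<^sub>R (\<omega> t / t)) \<in> borel_measurable borel"
          by (intro borel_measurable_continuous_on_indicator continuous_intros continuous_on_subset[OF w(1)]) auto
        then have "(\<lambda>t. ennreal (indicator {0<..<e} t *\<^sub>R (\<omega> t / t))) \<in> borel_measurable borel" by measurable
        also have "(\<lambda>t. ennreal (indicator {0<..<e} t *\<^sub>R (\<omega> t / t))) = (\<lambda>t. ennreal (\<omega> t / t) * indicator {0<..<e} t)"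
          by (auto simp: fun_eq_iff indicator_def)
        finally show ?thesis by simp
      qed
      have "(\<integral>\<^sup>+t\<in>{0<..<s}. ennreal (\<omega> t / t) \<partial>lborel)
        \<le> (\<integral>\<^sup>+t. ennreal (\<omega> t / t) * indicator {0<..<e} t + ennreal (\<omega> e / e) * indicator {e..s} t \<partial>lborel)"
      proof (rule nn_integral_mono)
        fix t
        show "ennreal (\<omega> t / t) * indicator {0<..<s} t
          \<le> ennreal (\<omega> t / t) * indicator {0<..<e} t + ennreal (\<omega> e / e) * indicator {e..s} t"
          using w(5)[of e t] e by (auto simp: indicator_def intro!: ennreal_leI)
      qed
      also have "\<dots> = (\<integral>\<^sup>+t\<in>{0<..<e}. ennreal (\<omega> t / t) \<partial>lborel) + ennreal (\<omega> e / e) * ennreal (s - e)"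
        using es by (subst nn_integral_add[OF me]) (simp_all add: nn_integral_cmult_indicator)
      also have "\<dots> \<le> ennreal (M * \<omega> e) + ennreal (\<omega> e / e) * ennreal 1"
        using s e by (intro add_mono M mult_left_mono ennreal_leI) auto
      also have "\<dots> = ennreal ((M + 1 / e) * \<omega> e)"
        using \<delta> e w(3)[of e] by (simp add: algebra_simps flip: ennreal_plus)
      also have "\<dots> \<le> ennreal ((M + 1 / e) * \<omega> s)"
        using \<delta> e es by (intro ennreal_leI mult_left_mono w(2)) auto
      finally show ?thesis .
    qed
  qed
qed

lemma growth_mono:
  assumes "majorant \<omega>" "0 < s" "s \<le> d" "0 \<le> M"
  shows "M * (\<omega> d / d) \<le> M * (\<omega> s / s)"
  using majorantD(5)[OF assms(1-3)] assms(4) by (rule mult_left_mono)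

lemma segment_integral:
  assumes f: "f holomorphic_on ball 0 1" and a: "a \<in> ball 0 1" and b: "b \<in> ball 0 1"
  shows "ennreal (cmod (f a - f b)) \<le> (\<integral>\<^sup>+t\<in>{0<..<1}. ennreal (cmod (b - a) * cmod (deriv f (a + of_real t * (b - a)))) \<partial>lborel)"
proof -
  have sub: "closed_segment a b \<subseteq> ball 0 1"
    using a b by (intro closed_segment_subset) auto
  have mem: "a + of_real t * (b - a) \<in> ball 0 1" if "t \<in> {0..1}" for t
  proof -
    have "linepath a b t \<in> closed_segment a b" using that by (intro linepath_in_path) auto
    moreover have "linepath a b t = a + of_real t * (b - a)"
      by (simp add: linepath_def scaleR_conv_of_real algebra_simps)
    ultimately show ?thesis using sub by auto
  qed
  have "(deriv f has_contour_integral (f (pathfinish (linepath a b)) - f (pathstart (linepath a b)))) (linepath a b)"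
  proof (rule contour_integral_primitive)
    fix x assume "x \<in> ball (0::complex) 1"
    then show "(f has_field_derivative deriv f x) (at x within ball 0 1)"
      using holomorphic_derivI[OF f open_ball] has_field_derivative_at_within by blast
  qed (use sub in auto)
  then have "((\<lambda>t. deriv f (linepath a b t) * (b - a)) has_integral f b - f a) {0..1}"
    by (simp add: has_contour_integral_linepath)
  moreover have "linepath a b t = a + of_real t * (b - a)" for t
    by (simp add: linepath_def scaleR_conv_of_real algebra_simps)
  ultimately have I: "((\<lambda>t. deriv f (a + of_real t * (b - a)) * (b - a)) has_integral f b - f a) {0..1}"
    by simp
  have contD: "continuous_on (ball 0 1) (deriv f)"
    using f holomorphic_deriv holomorphic_on_imp_continuous_on open_ball by blast
  have "continuous_on {0..1} (\<lambda>t. deriv f (a + of_real t * (b - a)) * (b - a))"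
    by (intro continuous_intros continuous_on_compose2[OF contD]) (use mem in auto)
  from norm_has_integral_le_nn_integral[OF I this]
  have "ennreal (cmod (f a - f b)) \<le> (\<integral>\<^sup>+t\<in>{0..1}. ennreal (cmod (b - a) * cmod (deriv f (a + of_real t * (b - a)))) \<partial>lborel)"
    by (simp add: norm_mult mult.commute norm_minus_commute)
  also have "\<dots> = (\<integral>\<^sup>+t\<in>{0<..<1}. ennreal (cmod (b - a) * cmod (deriv f (a + of_real t * (b - a)))) \<partial>lborel)"
  proof (rule nn_integral_cong_AE)
    show "AE t in lborel. ennreal (cmod (b - a) * cmod (deriv f (a + of_real t * (b - a)))) * indicator {0..1} t
       = ennreal (cmod (b - a) * cmod (deriv f (a + of_real t * (b - a)))) * indicator {0<..<1} t"
      using AE_lborel_singleton[of 0] AE_lborel_singleton[of "1::real"]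
      by eventually_elim (auto simp: indicator_def)
  qed
  finally show ?thesis .
qed

lemma borel_measurable_indicator_deriv:
  assumes "f holomorphic_on ball 0 1"
  shows "(\<lambda>z. cmod (indicator (ball 0 1) z *\<^sub>R deriv f z)) \<in> borel_measurable borel"
  using borel_measurable_norm_holomorphic(1)[OF holomorphic_deriv[OF assms open_ball] open_ball] .

text \<open>
  Minkowski's inequality applied to the integral of \<open>f'\<close> along a segment. The bound on the derivative
  may depend on the position \<open>t\<close>.
\<close>

lemma rot_bound_segment:
  assumes f: "f holomorphic_on ball 0 1" and a: "a \<in> ball 0 1" and b: "b \<in> ball 0 1" and p: "1 \<le> p"
    and k: "k \<in> borel_measurable borel" "\<And>t. t \<in> {0<..<1} \<Longrightarrow> 0 \<le> k t"
    and L: "cmod (b - a) \<le> L"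
    and bd: "\<And>t. t \<in> {0<..<1} \<Longrightarrow> rot_bound p (\<lambda>\<eta>. cmod (deriv f ((a + of_real t * (b - a)) * cis \<eta>))) (k t)"
    and S: "(\<integral>\<^sup>+t\<in>{0<..<1}. ennreal (L * k t) \<partial>lborel) \<le> ennreal S" "0 \<le> S"
  shows "rot_bound p (\<lambda>\<eta>. cmod (f (cis \<eta> * a) - f (cis \<eta> * b))) S"
proof -
  define D where "D z = cmod (indicator (ball 0 1) z *\<^sub>R deriv f z)" for z
  have D [measurable]: "D \<in> borel_measurable borel"
    unfolding D_def by (rule borel_measurable_indicator_deriv[OF f])
  have L0: "0 \<le> L" using L norm_ge_zero order_trans by blast
  have mem: "a + of_real t * (b - a) \<in> ball 0 1" if "t \<in> {0<..<1}" for t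
  proof -
    have "(1 - t) *\<^sub>R a + t *\<^sub>R b \<in> ball 0 1"
      using that a b by (intro convexD[OF convex_ball]) auto
    then show ?thesis by (simp add: scaleR_conv_of_real algebra_simps)
  qed
  have DD: "D ((a + of_real t * (b - a)) * cis \<eta>) = cmod (deriv f ((a + of_real t * (b - a)) * cis \<eta>))"
    if "t \<in> {0<..<1}" for t \<eta>
    using mem[OF that] by (simp add: D_def indicator_def norm_mult)
  show ?thesis
  proof (rule rot_bound_set_Minkowski[where A = "{0<..<1::real}" and k = "\<lambda>t. L * k t"
        and h = "\<lambda>t \<eta>. L * D ((a + of_real t * (b - a)) * cis \<eta>)"])
    show "(\<lambda>(t, \<eta>). L * D ((a + of_real t * (b - a)) * cis \<eta>)) \<in> borel_measurable (borel \<Otimes>\<^sub>M borel)"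
      by measurable
    show "0 \<le> L * D ((a + of_real t * (b - a)) * cis \<eta>)" for t \<eta>
      using L0 by (simp add: D_def)
    show "(\<lambda>t. L * k t) \<in> borel_measurable borel" using k(1) by measurable
    fix t :: real assume t: "t \<in> {0<..<1}"
    show "0 \<le> L * k t" using L0 k(2)[OF t] by simp
    show "rot_bound p (\<lambda>\<eta>. L * D ((a + of_real t * (b - a)) * cis \<eta>)) (L * k t)"
    proof (rule rot_bound_scale)
      show "rot_bound p (\<lambda>\<eta>. D ((a + of_real t * (b - a)) * cis \<eta>)) (k t)"
        using bd[OF t] by (simp only: DD[OF t])
      show "(\<lambda>\<eta>. D ((a + of_real t * (b - a)) * cis \<eta>)) \<in> borel_measurable borel" by measurable
    qed (use L0 k(2)[OF t] in \<open>auto simp: D_def\<close>)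
  next
    fix \<eta>
    have eq: "cis \<eta> * a + of_real t * (cis \<eta> * b - cis \<eta> * a) = (a + of_real t * (b - a)) * cis \<eta>" for t
      by (simp add: algebra_simps)
    have "cis \<eta> * b - cis \<eta> * a = cis \<eta> * (b - a)" by (simp add: algebra_simps)
    then have n: "cmod (cis \<eta> * b - cis \<eta> * a) = cmod (b - a)" by (simp add: norm_mult)
    have "ennreal (cmod (f (cis \<eta> * a) - f (cis \<eta> * b)))
      \<le> (\<integral>\<^sup>+t\<in>{0<..<1}. ennreal (cmod (b - a) * cmod (deriv f ((a + of_real t * (b - a)) * cis \<eta>))) \<partial>lborel)"
      using segment_integral[OF f, of "cis \<eta> * a" "cis \<eta> * b"] a b unfolding eq n by (simp add: norm_mult)
    also have "\<dots> \<le> (\<integral>\<^sup>+t\<in>{0<..<1}. ennreal (L * D ((a + of_real t * (b - a)) * cis \<eta>)) \<partial>lborel)"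
    proof (rule nn_integral_mono)
      fix t :: real
      show "ennreal (cmod (b - a) * cmod (deriv f ((a + of_real t * (b - a)) * cis \<eta>))) * indicator {0<..<1} t
        \<le> ennreal (L * D ((a + of_real t * (b - a)) * cis \<eta>)) * indicator {0<..<1} t"
        by (cases "t \<in> {0<..<1}") (auto simp: DD intro!: ennreal_leI mult_right_mono L)
    qed
    finally show "ennreal (cmod (f (cis \<eta> * a) - f (cis \<eta> * b)))
      \<le> (\<integral>\<^sup>+t\<in>{0<..<1}. ennreal (L * D ((a + of_real t * (b - a)) * cis \<eta>)) \<partial>lborel)" .
  qed (use S p in auto)
qed

lemma borel_measurable_rotated_diff:
  assumes f: "continuous_on (cball 0 1) f" and z: "z1 \<in> cball 0 1" "z2 \<in> cball 0 1"
  shows "(\<lambda>\<eta>. norm (f (cis \<eta> * z1) - f (cis \<eta> * z2))) \<in> borel_measurable borel"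
  by (intro borel_measurable_continuous_onI continuous_intros continuous_on_compose2[OF f])
     (use z in \<open>auto simp: norm_mult\<close>)

lemma Hardy_Littlewood_open_disk:
  assumes f: "f \<in> disk_algebra" and p: "1 \<le> p" and w: "majorant \<omega>"
    and M: "0 < M" "\<And>z. z \<in> ball 0 1 \<Longrightarrow> rot_bound p (\<lambda>\<eta>. cmod (deriv f (z * cis \<eta>))) (M * (\<omega> (disk_dist z) / disk_dist z))"
    and C: "0 < C" "\<And>s. 0 < s \<Longrightarrow> s \<le> 1 \<Longrightarrow> (\<integral>\<^sup>+t\<in>{0<..<s}. ennreal (\<omega> t / t) \<partial>lborel) \<le> ennreal (C * \<omega> s)"
    and z: "z1 \<in> ball 0 1" "z2 \<in> ball 0 1"
  shows "rot_bound p (\<lambda>\<eta>. cmod (f (cis \<eta> * z1) - f (cis \<eta> * z2))) ((2 * C + 1) * M * \<omega> (cmod (z1 - z2)))"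
proof (cases "z1 = z2")
  case True
  then show ?thesis using majorantD(4)[OF w] by (simp add: rot_bound_def)
next
  case False
  note w' = majorantD[OF w]
  have holf: "f holomorphic_on ball 0 1" and contf: "continuous_on (cball 0 1) f"
    using f by (auto simp: disk_algebra_def)
  define \<delta> where "\<delta> = cmod (z1 - z2)"
  define s where "s = min \<delta> 1"
  have \<delta>: "\<delta> > 0" using False by (simp add: \<delta>_def)
  then have s: "0 < s" "s \<le> 1" "s \<le> \<delta>" by (auto simp: s_def)
  have mem: "(1 - of_real s) * z \<in> ball 0 1" if "z \<in> ball 0 1" for z :: complex
  proof -
    have "cmod (1 - of_real s) = 1 - s" using norm_of_real[of "1 - s", where 'a = complex] s by simp
    then have "cmod ((1 - of_real s) * z) \<le> 1 * cmod z" unfolding norm_mult using s by (intro mult_right_mono) auto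
    then show ?thesis using that by simp
  qed
  \<comment> \<open>The point \<open>(1 - t s) z\<close> of the radial segment has distance at least \<open>t s\<close> from the circle.\<close>
  have radial: "rot_bound p (\<lambda>\<eta>. cmod (f (cis \<eta> * z) - f (cis \<eta> * ((1 - of_real s) * z)))) (M * (C * \<omega> s))"
    if z: "z \<in> ball 0 1" for z
  proof (rule rot_bound_segment[OF holf z mem[OF z] p, where L = s
        and k = "\<lambda>t. M * (indicator {0<..<1} t * (\<omega> (t * s) / (t * s)))"])
    have "(\<lambda>t. indicator {0<..<1} t *\<^sub>R (\<omega> (t * s) / (t * s))) \<in> borel_measurable borel"
      using s by (intro borel_measurable_continuous_on_indicator continuous_intros continuous_on_compose2[OF w'(1)]) auto
    then show "(\<lambda>t. M * (indicator {0<..<1} t * (\<omega> (t * s) / (t * s)))) \<in> borel_measurable borel"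
      unfolding real_scaleR_def by (rule borel_measurable_times[OF borel_measurable_const])
    have "(1 - of_real s) * z - z = - (of_real s * z)" by (simp add: algebra_simps)
    then have "cmod ((1 - of_real s) * z - z) = s * cmod z" using s by (simp add: norm_mult)
    also have "\<dots> \<le> s * 1" using z s by (intro mult_left_mono) auto
    finally show "cmod ((1 - of_real s) * z - z) \<le> s" by simp
    show "0 \<le> M * (C * \<omega> s)" using M C w'(3)[of s] s by simp
    show "0 \<le> M * (indicator {0<..<1} t * (\<omega> (t * s) / (t * s)))" if "t \<in> {0<..<1}" for t
      using that M s w'(3)[of "t * s"] by simp
  next
    fix t :: real assume t: "t \<in> {0<..<1}"
    have "t * s \<le> t * 1" using t s by (intro mult_left_mono) auto
    also have "t * 1 < 1" using t by simp
    finally have ts: "0 < t * s" "t * s < 1" using t s by auto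
    define \<zeta> where "\<zeta> = z + of_real t * ((1 - of_real s) * z - z)"
    have "\<zeta> = of_real (1 - t * s) * z" by (simp add: \<zeta>_def algebra_simps)
    then have "cmod \<zeta> = (1 - t * s) * cmod z" using ts by (simp add: norm_mult del: of_real_diff)
    also have "\<dots> \<le> (1 - t * s) * 1" using ts z by (intro mult_left_mono) auto
    finally have d: "t * s \<le> disk_dist \<zeta>" by (simp add: disk_dist_def)
    then have \<zeta>: "\<zeta> \<in> ball 0 1" using ts by (simp add: disk_dist_def)
    have "rot_bound p (\<lambda>\<eta>. cmod (deriv f (\<zeta> * cis \<eta>))) (M * (\<omega> (t * s) / (t * s)))"
      using M(1) d ts w'(3)[of "disk_dist \<zeta>"]
      by (intro rot_bound_mono[OF M(2)[OF \<zeta>]] growth_mono[OF w]) auto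
    then show "rot_bound p (\<lambda>\<eta>. cmod (deriv f ((z + of_real t * ((1 - of_real s) * z - z)) * cis \<eta>)))
       (M * (indicator {0<..<1} t * (\<omega> (t * s) / (t * s))))"
      using t by (simp add: \<zeta>_def)
  next
    define W where "W t = ennreal (indicator {0<..<s} t *\<^sub>R (\<omega> t / t))" for t
    have [measurable]: "W \<in> borel_measurable borel"
    proof -
      have "(\<lambda>t. indicator {0<..<s} t *\<^sub>R (\<omega> t / t)) \<in> borel_measurable borel"
        by (intro borel_measurable_continuous_on_indicator continuous_intros continuous_on_subset[OF w'(1)]) auto
      then show ?thesis unfolding W_def by measurable
    qed
    have "(\<integral>\<^sup>+t\<in>{0<..<1}. ennreal (s * (M * (indicator {0<..<1} t * (\<omega> (t * s) / (t * s))))) \<partial>lborel)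
        = (\<integral>\<^sup>+t. ennreal M * (ennreal s * W (0 + s * t)) \<partial>lborel)"
    proof (intro nn_integral_cong)
      fix t :: real
      have "s * t \<in> {0<..<s} \<longleftrightarrow> t \<in> {0<..<1}" using s by (auto simp: zero_less_mult_iff)
      then show "ennreal (s * (M * (indicator {0<..<1} t * (\<omega> (t * s) / (t * s))))) * indicator {0<..<1} t
        = ennreal M * (ennreal s * W (0 + s * t))"
        using s M w'(3)[of "t * s"]
        by (cases "t \<in> {0<..<1}") (auto simp: W_def mult_ac indicator_def simp flip: ennreal_mult)
    qed
    also have "\<dots> = ennreal M * (ennreal \<bar>s\<bar> * (\<integral>\<^sup>+t. W (0 + s * t) \<partial>lborel))"
      using s by (simp add: nn_integral_cmult)
    also have "\<dots> = ennreal M * (\<integral>\<^sup>+t. W t \<partial>lborel)"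
      using s by (subst nn_integral_real_affine[of W s 0]) auto
    also have "(\<integral>\<^sup>+t. W t \<partial>lborel) = (\<integral>\<^sup>+t\<in>{0<..<s}. ennreal (\<omega> t / t) \<partial>lborel)"
      by (intro nn_integral_cong) (auto simp: W_def indicator_def)
    also have "ennreal M * \<dots> \<le> ennreal M * ennreal (C * \<omega> s)"
      by (intro mult_left_mono C s) auto
    also have "\<dots> = ennreal (M * (C * \<omega> s))"
      using M C w'(3)[of s] s by (simp flip: ennreal_mult)
    finally show "(\<integral>\<^sup>+t\<in>{0<..<1}. ennreal (s * (M * (indicator {0<..<1} t * (\<omega> (t * s) / (t * s))))) \<partial>lborel)
       \<le> ennreal (M * (C * \<omega> s))" .
  qed
  have middle: "rot_bound p (\<lambda>\<eta>. cmod (f (cis \<eta> * ((1 - of_real s) * z1)) - f (cis \<eta> * ((1 - of_real s) * z2)))) (M * \<omega> s)"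
  proof (rule rot_bound_segment[OF holf mem[OF z(1)] mem[OF z(2)] p, where L = s and k = "\<lambda>_. M * (\<omega> s / s)"])
    have n: "cmod (1 - of_real s) = 1 - s" using norm_of_real[of "1 - s", where 'a = complex] s by simp
    have "cmod ((1 - of_real s) * z2 - (1 - of_real s) * z1) = (1 - s) * \<delta>"
      unfolding right_diff_distrib[symmetric] norm_mult n by (simp add: \<delta>_def norm_minus_commute)
    also have "\<dots> \<le> s"
    proof (cases "\<delta> \<le> 1")
      case True
      have "(1 - s) * \<delta> \<le> 1 * \<delta>" using s \<delta> by (intro mult_right_mono) auto
      then show ?thesis using True by (simp add: s_def)
    qed (simp add: s_def)
    finally show "cmod ((1 - of_real s) * z2 - (1 - of_real s) * z1) \<le> s" .
    show "(\<integral>\<^sup>+t\<in>{0<..<1::real}. ennreal (s * (M * (\<omega> s / s))) \<partial>lborel) \<le> ennreal (M * \<omega> s)"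
      using s by (subst nn_integral_cmult_indicator) auto
    show "0 \<le> M * \<omega> s" "\<And>t. 0 \<le> M * (\<omega> s / s)" using M w'(3)[of s] s by auto
    fix t :: real assume t: "t \<in> {0<..<1}"
    define \<zeta> where "\<zeta> = (1 - of_real s) * z1 + of_real t * ((1 - of_real s) * z2 - (1 - of_real s) * z1)"
    define x where "x = (1 - t) *\<^sub>R z1 + t *\<^sub>R z2"
    have "\<zeta> = (1 - of_real s) * x"
      by (simp add: x_def \<zeta>_def scaleR_conv_of_real algebra_simps)
    then have "cmod \<zeta> = (1 - s) * cmod x" using n by (simp add: norm_mult)
    also have "x \<in> ball 0 1"
      unfolding x_def using t z by (intro convexD[OF convex_ball]) auto
    then have "(1 - s) * cmod x \<le> (1 - s) * 1" using s by (intro mult_left_mono) auto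
    finally have "cmod \<zeta> \<le> 1 - s" by simp
    then have d: "s \<le> disk_dist \<zeta>" by (simp add: disk_dist_def)
    then have \<zeta>: "\<zeta> \<in> ball 0 1" using s by (simp add: disk_dist_def)
    have "rot_bound p (\<lambda>\<eta>. cmod (deriv f (\<zeta> * cis \<eta>))) (M * (\<omega> s / s))"
      using M(1) d s w'(3)[of "disk_dist \<zeta>"]
      by (intro rot_bound_mono[OF M(2)[OF \<zeta>]] growth_mono[OF w]) auto
    then show "rot_bound p (\<lambda>\<eta>. cmod (deriv f (((1 - of_real s) * z1 + of_real t * ((1 - of_real s) * z2 - (1 - of_real s) * z1)) * cis \<eta>)))
       (M * (\<omega> s / s))" by (simp add: \<zeta>_def)
  qed simp
  let ?m = "\<lambda>z. (1 - complex_of_real s) * z"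
  let ?d = "\<lambda>a b \<eta>. cmod (f (cis \<eta> * a) - f (cis \<eta> * b))"
  have cb: "z1 \<in> cball 0 1" "z2 \<in> cball 0 1" "?m z1 \<in> cball 0 1" "?m z2 \<in> cball 0 1"
    using z mem[OF z(1)] mem[OF z(2)] by (auto simp: less_imp_le)
  note ms = borel_measurable_rotated_diff[OF contf]
  have nn: "0 \<le> M * (C * \<omega> s)" "0 \<le> M * \<omega> s" using M C w'(3)[of s] s by auto
  have 1: "rot_bound p (?d z1 (?m z2)) (M * (C * \<omega> s) + M * \<omega> s)"
  proof (rule rot_bound_add[OF p radial[OF z(1)] middle])
    show "?d z1 (?m z2) \<eta> \<le> ?d z1 (?m z1) \<eta> + ?d (?m z1) (?m z2) \<eta>" for \<eta>
      using dist_triangle[of "f (cis \<eta> * z1)" "f (cis \<eta> * ?m z2)" "f (cis \<eta> * ?m z1)"] by (simp add: dist_norm)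
  qed (use nn cb ms in \<open>auto simp del: mem_cball mem_cball_0\<close>)
  have 2: "rot_bound p (?d z1 z2) (M * (C * \<omega> s) + M * \<omega> s + M * (C * \<omega> s))"
  proof (rule rot_bound_add[OF p 1 radial[OF z(2)]])
    show "?d z1 z2 \<eta> \<le> ?d z1 (?m z2) \<eta> + ?d z2 (?m z2) \<eta>" for \<eta>
      using dist_triangle2[of "f (cis \<eta> * z1)" "f (cis \<eta> * z2)" "f (cis \<eta> * ?m z2)"] by (simp add: dist_norm)
  qed (use nn cb ms in \<open>auto simp del: mem_cball mem_cball_0\<close>)
  show ?thesis
  proof (rule rot_bound_mono[OF 2])
    have "(2 * C + 1) * M * \<omega> s \<le> (2 * C + 1) * M * \<omega> \<delta>"
      using M C s by (intro mult_left_mono w') auto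
    then show "M * (C * \<omega> s) + M * \<omega> s + M * (C * \<omega> s) \<le> (2 * C + 1) * M * \<omega> (cmod (z1 - z2))"
      by (simp add: algebra_simps \<delta>_def)
  qed (use nn in \<open>simp_all add: mult.left_commute\<close>)
qed

text \<open>
  The constants on the open disk are uniform, so points of the closed disk are approached along radii.
\<close>

lemma Hardy_Littlewood_closed_disk:
  assumes f: "f \<in> disk_algebra" and p: "1 \<le> p" and w: "fast_majorant \<omega>"
    and M: "0 < M" "\<And>z. z \<in> ball 0 1 \<Longrightarrow> rot_bound p (\<lambda>\<eta>. cmod (deriv f (z * cis \<eta>))) (M * (\<omega> (disk_dist z) / disk_dist z))"
  obtains M' where "0 < M'" "\<And>z1 z2. z1 \<in> cball 0 1 \<Longrightarrow> z2 \<in> cball 0 1 \<Longrightarrow>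
    rot_bound p (\<lambda>\<eta>. cmod (f (cis \<eta> * z1) - f (cis \<eta> * z2))) (M' * \<omega> (cmod (z1 - z2)))"
proof -
  obtain C where C: "0 < C"
    "\<And>s. 0 < s \<Longrightarrow> s \<le> 1 \<Longrightarrow> (\<integral>\<^sup>+t\<in>{0<..<s}. ennreal (\<omega> t / t) \<partial>lborel) \<le> ennreal (C * \<omega> s)"
    using fast_majorant_integral[OF w] by metis
  have maj: "majorant \<omega>" using w by (simp add: fast_majorant_def)
  have contf: "continuous_on (cball 0 1) f" using f by (auto simp: disk_algebra_def)
  show ?thesis
  proof (rule that[of "(2 * C + 1) * M"])
    show "0 < (2 * C + 1) * M" using C M by (simp add: add_pos_pos)
    fix z1 z2 :: complex assume z: "z1 \<in> cball 0 1" "z2 \<in> cball 0 1"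
    define r where "r n = 1 - 1 / real (n + 2)" for n :: nat
    have r: "0 < r n" "r n < 1" for n by (auto simp: r_def)
    have rlim: "r \<longlonglongrightarrow> 1"
    proof -
      have "(\<lambda>n. 1 / real (n + 2)) \<longlonglongrightarrow> 0" by real_asymp
      from tendsto_diff[OF tendsto_const[of 1] this] show ?thesis by (simp add: r_def [abs_def])
    qed
    have mem: "of_real (r n) * z \<in> ball 0 1" if "z \<in> cball 0 1" for n and z :: complex
    proof -
      have "cmod (of_real (r n) * z) \<le> r n * 1"
        unfolding norm_mult using r[of n] that by (auto intro!: mult_left_mono)
      also have "\<dots> < 1" using r by simp
      finally show ?thesis by simp
    qed
    show "rot_bound p (\<lambda>\<eta>. cmod (f (cis \<eta> * z1) - f (cis \<eta> * z2))) ((2 * C + 1) * M * \<omega> (cmod (z1 - z2)))"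
    proof (rule rot_bound_limit[OF _ _ _ _ p])
      fix n
      have "cmod (of_real (r n) * z1 - of_real (r n) * z2) = r n * cmod (z1 - z2)"
        unfolding right_diff_distrib[symmetric] norm_mult using r[of n] by simp
      also have "\<dots> \<le> 1 * cmod (z1 - z2)" using r[of n] by (intro mult_right_mono) auto
      finally have "\<omega> (cmod (of_real (r n) * z1 - of_real (r n) * z2)) \<le> \<omega> (cmod (z1 - z2))"
        by (intro majorantD(2)[OF maj]) auto
      then show "rot_bound p (\<lambda>\<eta>. cmod (f (cis \<eta> * (of_real (r n) * z1)) - f (cis \<eta> * (of_real (r n) * z2))))
          ((2 * C + 1) * M * \<omega> (cmod (z1 - z2)))"
        using C M majorantD(3)[OF maj]
        by (intro rot_bound_mono[OF Hardy_Littlewood_open_disk[OF f p maj M C mem[OF z(1)] mem[OF z(2)]]] mult_left_mono) auto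
      show "(\<lambda>\<eta>. cmod (f (cis \<eta> * (of_real (r n) * z1)) - f (cis \<eta> * (of_real (r n) * z2)))) \<in> borel_measurable borel"
        using mem[OF z(1), of n] mem[OF z(2), of n]
        by (intro borel_measurable_rotated_diff[OF contf]) (auto simp: less_imp_le)
    next
      fix \<eta> :: real
      have lim: "(\<lambda>n. f (cis \<eta> * (of_real (r n) * z))) \<longlonglongrightarrow> f (cis \<eta> * z)" if z: "z \<in> cball 0 1" for z
      proof (rule continuous_on_tendsto_compose[OF contf])
        have "(\<lambda>n. cis \<eta> * (of_real (r n) * z)) \<longlonglongrightarrow> cis \<eta> * (of_real 1 * z)"
          by (intro tendsto_intros rlim)
        then show "(\<lambda>n. cis \<eta> * (of_real (r n) * z)) \<longlonglongrightarrow> cis \<eta> * z" by simp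
      qed (use mem[OF z] z in \<open>auto simp: less_imp_le norm_mult\<close>)
      show "(\<lambda>n. cmod (f (cis \<eta> * (of_real (r n) * z1)) - f (cis \<eta> * (of_real (r n) * z2))))
          \<longlonglongrightarrow> cmod (f (cis \<eta> * z1) - f (cis \<eta> * z2))"
        by (intro tendsto_norm tendsto_diff lim z)
    qed simp
  qed
qed

section \<open>Oscillation of a supported function bounds the derivative\<close>

lemma deriv_rotate:
  assumes f: "f holomorphic_on ball 0 1" and z: "z \<in> ball 0 1"
  shows "deriv (\<lambda>w. f (cis \<eta> * w)) z = cis \<eta> * deriv f (z * cis \<eta>)"
proof (rule DERIV_imp_deriv)
  have "cis \<eta> * z \<in> ball 0 1" using z by (simp add: norm_mult)
  from holomorphic_derivI[OF f open_ball this]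
  have D: "(f has_field_derivative deriv f (z * cis \<eta>)) (at (cis \<eta> * z))" by (simp add: mult.commute)
  have "((\<lambda>w. cis \<eta> * w) has_field_derivative cis \<eta>) (at z)"
    by (auto intro!: derivative_eq_intros)
  from DERIV_chain2[OF D this] show "((\<lambda>w. f (cis \<eta> * w)) has_field_derivative cis \<eta> * deriv f (z * cis \<eta>)) (at z)"
    by (simp add: mult.commute)
qed

lemma rotated_disk_algebra:
  assumes f: "f \<in> disk_algebra" and z: "cball z r \<subseteq> ball 0 1"
  shows "continuous_on (cball z r) (\<lambda>w. f (cis \<eta> * w))" "(\<lambda>w. f (cis \<eta> * w)) holomorphic_on ball z r"
proof -
  have holf: "f holomorphic_on ball 0 1" using f by (simp add: disk_algebra_def)
  have "(\<lambda>w. f (cis \<eta> * w)) holomorphic_on cball z r"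
    by (rule holomorphic_on_compose_gen[OF _ holf, of "\<lambda>w. cis \<eta> * w", unfolded o_def])
       (use z in \<open>auto intro!: holomorphic_intros simp: norm_mult subset_iff\<close>)
  then show "continuous_on (cball z r) (\<lambda>w. f (cis \<eta> * w))" "(\<lambda>w. f (cis \<eta> * w)) holomorphic_on ball z r"
    using holomorphic_on_imp_continuous_on holomorphic_on_subset ball_subset_cball by blast+
qed

lemma half_disk_subset:
  assumes "z \<in> ball 0 1"
  shows "cball z (disk_dist z / 2) \<subseteq> ball 0 1"
proof
  fix \<xi> assume "\<xi> \<in> cball z (disk_dist z / 2)"
  then have "cmod (\<xi> - z) \<le> (1 - cmod z) / 2" by (simp add: dist_norm norm_minus_commute disk_dist_def)
  moreover have "cmod \<xi> \<le> cmod z + cmod (\<xi> - z)" by (metis norm_triangle_sub)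
  ultimately show "\<xi> \<in> ball 0 1" using assms by (simp add: field_simps)
qed

lemma half_disk_in_disk: "z \<in> ball 0 1 \<Longrightarrow> \<xi> \<in> half_disk z \<Longrightarrow> \<xi> \<in> ball 0 1"
  by (rule subsetD[OF half_disk_subset]) (auto simp: half_disk_def)

text \<open>
  At every point \<open>g\<close> is touched from below by a harmonic function \<open>Re (c f)\<close> with \<open>c\<close> unimodular.
\<close>

definition supported_by :: "(complex \<Rightarrow> complex) \<Rightarrow> (complex \<Rightarrow> real) \<Rightarrow> bool" where
  "supported_by f g \<longleftrightarrow> (\<forall>z\<in>ball 0 1. \<exists>c. cmod c = 1 \<and> Re (c * f z) = g z \<and>
     (\<forall>\<zeta>\<in>ball 0 1. Re (c * f \<zeta>) \<le> g \<zeta>))"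

text \<open>
  The circle estimate is applied to the rotated function \<open>f (cis \<eta> * w)\<close> on the circle of radius
  \<open>d / 2\<close> about \<open>z\<close>. The touching constant \<open>c\<close> depends on \<open>\<eta>\<close>, which is harmless because \<open>c\<close> does
  not occur in the resulting estimate.
\<close>

lemma oscillation_controls_derivative:
  assumes f: "f \<in> disk_algebra" and p: "1 \<le> p" and w: "majorant \<omega>"
    and g: "continuous_on (cball 0 1) g" and sup: "supported_by f g"
    and M: "0 < M" "\<And>z1 z2. z1 \<in> cball 0 1 \<Longrightarrow> z2 \<in> cball 0 1 \<Longrightarrow>
      rot_bound p (\<lambda>\<eta>. \<bar>g (cis \<eta> * z1) - g (cis \<eta> * z2)\<bar>) (M * \<omega> (cmod (z1 - z2)))"
    and z: "z \<in> ball 0 1"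
  shows "rot_bound p (\<lambda>\<eta>. cmod (deriv f (z * cis \<eta>))) (8 * M * (\<omega> (disk_dist z) / disk_dist z))"
proof -
  note w' = majorantD[OF w]
  have holf: "f holomorphic_on ball 0 1" using f by (simp add: disk_algebra_def)
  define d where "d = disk_dist z"
  define r where "r = d / 2"
  have d: "0 < d" using z by (simp add: d_def disk_dist_def)
  then have r: "0 < r" by (simp add: r_def)
  have sub: "cball z r \<subseteq> ball 0 1" using half_disk_subset[OF z] by (simp add: r_def d_def)
  have mem: "z + of_real r * cis t \<in> ball 0 1" for t
    by (rule subsetD[OF sub]) (use r in \<open>simp add: dist_norm norm_mult\<close>)
  have mem': "cis \<eta> * w \<in> ball 0 1" if "w \<in> cball z r" for w \<eta>
    using sub that by (auto simp: norm_mult)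
  define h where "h t \<eta> = 2 / (pi * r) * \<bar>g (cis \<eta> * (z + of_real r * cis t)) - g (cis \<eta> * z)\<bar>" for t \<eta>
  have 1: "continuous_on UNIV (\<lambda>x. \<bar>g (cis (snd x) * (z + of_real r * cis (fst x))) - g (cis (snd x) * z)\<bar>)"
    using mem z
    by (intro continuous_intros continuous_on_compose2[OF g]) (auto simp: norm_mult less_imp_le)
  have "rot_bound p (\<lambda>\<eta>. cmod (deriv f (z * cis \<eta>))) (2 * pi * (2 / (pi * r) * (M * \<omega> r)))"
  proof (rule rot_bound_set_Minkowski[where A = "{0..2*pi}" and h = h and k = "\<lambda>_. 2 / (pi * r) * (M * \<omega> r)"])
    show "(\<lambda>(t, \<eta>). h t \<eta>) \<in> borel_measurable (borel \<Otimes>\<^sub>M borel)"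
      unfolding h_def case_prod_beta' borel_prod
      by (intro borel_measurable_times[OF borel_measurable_const] borel_measurable_continuous_onI 1)
    show "(\<integral>\<^sup>+t\<in>{0..2*pi}. ennreal (2 / (pi * r) * (M * \<omega> r)) \<partial>lborel) \<le> ennreal (2 * pi * (2 / (pi * r) * (M * \<omega> r)))"
      using r M w'(3)[of r] by (subst nn_integral_cmult_indicator) (simp_all add: mult.commute flip: ennreal_mult)
    fix t :: real
    have "cmod (z + of_real r * cis t - z) = r" using r by (simp add: norm_mult)
    then have b: "rot_bound p (\<lambda>\<eta>. \<bar>g (cis \<eta> * (z + of_real r * cis t)) - g (cis \<eta> * z)\<bar>) (M * \<omega> r)"
      using M(2)[of "z + of_real r * cis t" z] mem[of t] z by (simp add: less_imp_le)
    have m: "(\<lambda>\<eta>. \<bar>g (cis \<eta> * (z + of_real r * cis t)) - g (cis \<eta> * z)\<bar>) \<in> borel_measurable borel"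
      using borel_measurable_rotated_diff[OF g, of "z + of_real r * cis t" z] mem[of t] z by (simp add: less_imp_le)
    show "rot_bound p (h t) (2 / (pi * r) * (M * \<omega> r))"
      unfolding h_def using r M w'(3)[of r] by (intro rot_bound_scale b m) auto
  next
    fix \<eta> :: real
    have "cis \<eta> * z \<in> ball 0 1" using z by (simp add: norm_mult)
    then obtain c where c: "cmod c = 1" "Re (c * f (cis \<eta> * z)) = g (cis \<eta> * z)"
      "\<And>\<zeta>. \<zeta> \<in> ball 0 1 \<Longrightarrow> Re (c * f \<zeta>) \<le> g \<zeta>"
      using sup unfolding supported_by_def by blast
    have cg: "continuous_on (cball z r) (\<lambda>w. g (cis \<eta> * w))"
      by (rule continuous_on_compose2[OF g]) (use mem' in \<open>auto intro!: continuous_intros simp: less_imp_le\<close>)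
    have "ennreal (cmod (deriv (\<lambda>w. f (cis \<eta> * w)) z))
      \<le> (\<integral>\<^sup>+t\<in>{0..2*pi}. ennreal (2 / (pi * r) * \<bar>g (cis \<eta> * (z + of_real r * cis t)) - g (cis \<eta> * z)\<bar>) \<partial>lborel)"
      by (rule deriv_le_circle_oscillation[OF r rotated_disk_algebra[OF f sub] cg c(1)])
         (use c mem' in blast)+
    then show "ennreal (cmod (deriv f (z * cis \<eta>))) \<le> (\<integral>\<^sup>+t\<in>{0..2*pi}. ennreal (h t \<eta>) \<partial>lborel)"
      by (simp add: deriv_rotate[OF holf z] norm_mult h_def)
  qed (use p r M w'(3)[of r] in \<open>auto simp: h_def\<close>)
  then show ?thesis
  proof (rule rot_bound_mono)
    have "2 * pi * (2 / (pi * r) * (M * \<omega> r)) = 8 * M * (\<omega> r / d)"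
      using d by (simp add: r_def field_simps)
    also have "\<dots> \<le> 8 * M * (\<omega> d / d)"
      using M d by (intro mult_left_mono divide_right_mono w'(2)) (auto simp: r_def)
    finally show "2 * pi * (2 / (pi * r) * (M * \<omega> r)) \<le> 8 * M * (\<omega> (disk_dist z) / disk_dist z)"
      by (simp add: d_def)
  qed (use r M w'(3)[of r] in auto)
qed

section \<open>Area means of the dilation\<close>

lemma max_dilation_Re:
  assumes f: "f holomorphic_on ball 0 1" and u: "\<And>\<zeta>. \<zeta> \<in> ball 0 1 \<Longrightarrow> u \<zeta> = Re (f \<zeta>)" and z: "z \<in> ball 0 1"
  shows "max_dilation (\<lambda>\<zeta>. complex_of_real (u \<zeta>)) z = cmod (deriv f z)"
proof -
  define D where "D = deriv f z"
  have "(f has_derivative (\<lambda>h. D * h)) (at z)"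
    using holomorphic_derivI[OF f open_ball z] by (simp add: has_field_derivative_def D_def)
  then have "((\<lambda>\<zeta>. complex_of_real (Re (f \<zeta>))) has_derivative (\<lambda>h. complex_of_real (Re (D * h)))) (at z)"
    by (intro has_derivative_of_real has_derivative_Re)
  then have "((\<lambda>\<zeta>. complex_of_real (u \<zeta>)) has_derivative (\<lambda>h. complex_of_real (Re (D * h)))) (at z)"
    by (rule has_derivative_transform_within_open[OF _ open_ball z]) (simp add: u)
  then have fr: "frechet_derivative (\<lambda>\<zeta>. complex_of_real (u \<zeta>)) (at z) = (\<lambda>h. complex_of_real (Re (D * h)))"
    by (rule frechet_derivative_at[symmetric])
  have W: "wirtinger (\<lambda>\<zeta>. complex_of_real (u \<zeta>)) z = D / 2" "wirtinger_bar (\<lambda>\<zeta>. complex_of_real (u \<zeta>)) z = cnj D / 2"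
    by (simp_all add: wirtinger_def wirtinger_bar_def fr complex_eq_iff)
  show ?thesis unfolding max_dilation_def W by (simp add: D_def norm_divide)
qed

text \<open>
  The mean of \<open>|f'|\<^sup>q\<close> over the rotated disk, as a real number; it is finite by
  \<open>deriv_mean_eq\<close>.
\<close>

definition deriv_mean :: "(complex \<Rightarrow> complex) \<Rightarrow> real \<Rightarrow> complex \<Rightarrow> real \<Rightarrow> real" where
  "deriv_mean f q z \<eta> =
     enn2real ((\<integral>\<^sup>+\<xi>\<in>half_disk z. ennreal (cmod (deriv f (\<xi> * cis \<eta>)) powr q) \<partial>lborel) / emeasure lborel (half_disk z))"

lemma emeasure_half_disk:
  assumes "z \<in> ball 0 1"
  shows "emeasure lborel (half_disk z) = ennreal (pi * (disk_dist z / 2)\<^sup>2)" "0 < pi * (disk_dist z / 2)\<^sup>2"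
  using assms by (simp_all add: half_disk_def emeasure_ball_complex disk_dist_def)

text \<open>
  The closed disk of half the boundary distance is a compact subset of the unit disk, so \<open>f'\<close> is
  bounded on it.
\<close>

lemma deriv_mean_eq:
  assumes f: "f holomorphic_on ball 0 1" and q: "0 < q" and z: "z \<in> ball 0 1"
  shows "(\<integral>\<^sup>+\<xi>\<in>half_disk z. ennreal (cmod (deriv f (\<xi> * cis \<eta>)) powr q) \<partial>lborel) / emeasure lborel (half_disk z)
     = ennreal (deriv_mean f q z \<eta>)"
proof -
  have hol: "deriv f holomorphic_on ball 0 1" by (rule holomorphic_deriv[OF f open_ball])
  have sub: "cball z (disk_dist z / 2) \<subseteq> ball 0 1" by (rule half_disk_subset[OF z])
  have "continuous_on (cball z (disk_dist z / 2)) (\<lambda>\<xi>. cmod (deriv f (\<xi> * cis \<eta>)))"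
    using sub by (intro continuous_intros continuous_on_compose2[OF holomorphic_on_imp_continuous_on[OF hol]])
                 (auto simp: norm_mult subset_iff)
  then have "bounded ((\<lambda>\<xi>. cmod (deriv f (\<xi> * cis \<eta>))) ` cball z (disk_dist z / 2))"
    by (intro compact_imp_bounded compact_continuous_image) auto
  then obtain K where K: "\<And>\<xi>. \<xi> \<in> cball z (disk_dist z / 2) \<Longrightarrow> cmod (deriv f (\<xi> * cis \<eta>)) \<le> K"
    unfolding bounded_iff by force
  have "(\<integral>\<^sup>+\<xi>\<in>half_disk z. ennreal (cmod (deriv f (\<xi> * cis \<eta>)) powr q) \<partial>lborel)
      \<le> (\<integral>\<^sup>+\<xi>\<in>half_disk z. ennreal (K powr q) \<partial>lborel)"
  proof (rule nn_integral_mono)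
    fix \<xi>
    show "ennreal (cmod (deriv f (\<xi> * cis \<eta>)) powr q) * indicator (half_disk z) \<xi> \<le> ennreal (K powr q) * indicator (half_disk z) \<xi>"
      using K[of \<xi>] q by (cases "\<xi> \<in> half_disk z") (auto simp: half_disk_def intro!: ennreal_leI powr_mono2)
  qed
  also have "\<dots> = ennreal (K powr q) * emeasure lborel (half_disk z)"
    by (rule nn_integral_cmult_indicator) (simp add: half_disk_def)
  also have "\<dots> < \<infinity>" using emeasure_half_disk[OF z] by (simp add: ennreal_mult_less_top)
  finally have "(\<integral>\<^sup>+\<xi>\<in>half_disk z. ennreal (cmod (deriv f (\<xi> * cis \<eta>)) powr q) \<partial>lborel) \<noteq> top" by simp
  then have "(\<integral>\<^sup>+\<xi>\<in>half_disk z. ennreal (cmod (deriv f (\<xi> * cis \<eta>)) powr q) \<partial>lborel) / emeasure lborel (half_disk z) \<noteq> top"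
    using emeasure_half_disk[OF z] by (simp add: ennreal_divide_eq_top_iff ennreal_eq_0_iff)
  then show ?thesis by (simp add: deriv_mean_def less_top)
qed

lemma dilation_mean_le_iff:
  assumes f: "f holomorphic_on ball 0 1" and u: "\<And>\<zeta>. \<zeta> \<in> ball 0 1 \<Longrightarrow> u \<zeta> = Re (f \<zeta>)" and z: "z \<in> ball 0 1"
    and p: "1 \<le> p" and q: "0 < q" and c: "0 \<le> c"
  shows "dilation_mean u q p z \<le> ennreal c \<longleftrightarrow> rot_bound p (\<lambda>\<eta>. deriv_mean f q z \<eta> powr (1 / q)) c"
proof -
  have inner: "(\<integral>\<^sup>+\<xi>\<in>half_disk z. ennreal (max_dilation (\<lambda>\<zeta>. complex_of_real (u \<zeta>)) (\<xi> * cis \<eta>) powr q) \<partial>lborel) / emeasure lborel (half_disk z)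
      = ennreal (deriv_mean f q z \<eta>)" for \<eta>
  proof -
    have "max_dilation (\<lambda>\<zeta>. complex_of_real (u \<zeta>)) (\<xi> * cis \<eta>) = cmod (deriv f (\<xi> * cis \<eta>))" if "\<xi> \<in> half_disk z" for \<xi>
    proof -
      have "\<xi> \<in> ball 0 1" by (rule half_disk_in_disk[OF z that])
      then have "\<xi> * cis \<eta> \<in> ball 0 1" by (simp add: norm_mult)
      then show ?thesis by (intro max_dilation_Re f u)
    qed
    then have "(\<integral>\<^sup>+\<xi>\<in>half_disk z. ennreal (max_dilation (\<lambda>\<zeta>. complex_of_real (u \<zeta>)) (\<xi> * cis \<eta>) powr q) \<partial>lborel)
        = (\<integral>\<^sup>+\<xi>\<in>half_disk z. ennreal (cmod (deriv f (\<xi> * cis \<eta>)) powr q) \<partial>lborel)"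
      by (intro nn_integral_cong) (simp add: indicator_def)
    then show ?thesis using deriv_mean_eq[OF f q z] by simp
  qed
  have m0: "0 \<le> deriv_mean f q z \<eta>" for \<eta> by (simp add: deriv_mean_def)
  show ?thesis
  proof (cases "p = \<infinity>")
    case True
    then show ?thesis using inner[of 0] m0 c
      by (simp add: dilation_mean_def Let_def rot_bound_def ennreal_powr_def)
  next
    case False
    have "0 < enn2real p" using enn2real_exponent_ge_1[OF p False] by simp
    then show ?thesis using False m0 c
      by (simp add: dilation_mean_def Let_def rot_bound_def ennreal_powr_inverse_le_iff inner powr_powr)
         (simp add: ennreal_powr_def)
  qed
qed

lemma measurable_deriv_mean:
  assumes f: "f holomorphic_on ball 0 1" and z: "z \<in> ball 0 1"
  shows "deriv_mean f q z \<in> borel_measurable borel"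
proof -
  define D where "D z = cmod (indicator (ball 0 1) z *\<^sub>R deriv f z)" for z
  have D [measurable]: "D \<in> borel_measurable borel"
    unfolding D_def by (rule borel_measurable_indicator_deriv[OF f])
  have "(\<integral>\<^sup>+\<xi>\<in>half_disk z. ennreal (cmod (deriv f (\<xi> * cis \<eta>)) powr q) \<partial>lborel)
      = (\<integral>\<^sup>+\<xi>. ennreal (D (\<xi> * cis \<eta>) powr q) * indicator (ball z (disk_dist z / 2)) \<xi> \<partial>lborel)" for \<eta>
  proof (intro nn_integral_cong)
    fix \<xi>
    show "ennreal (cmod (deriv f (\<xi> * cis \<eta>)) powr q) * indicator (half_disk z) \<xi>
      = ennreal (D (\<xi> * cis \<eta>) powr q) * indicator (ball z (disk_dist z / 2)) \<xi>"
      using half_disk_in_disk[OF z, of \<xi>] unfolding half_disk_def[symmetric]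
      by (cases "\<xi> \<in> half_disk z") (auto simp: D_def indicator_def norm_mult)
  qed
  then have eq: "deriv_mean f q z = (\<lambda>\<eta>. enn2real ((\<integral>\<^sup>+\<xi>. ennreal (D (\<xi> * cis \<eta>) powr q) * indicator (ball z (disk_dist z / 2)) \<xi> \<partial>lborel) / emeasure lborel (half_disk z)))"
    by (simp add: fun_eq_iff deriv_mean_def)
  have [measurable]: "ball z (disk_dist z / 2) \<in> sets borel" by simp
  show ?thesis unfolding eq by measurable
qed

text \<open>
  Minkowski's inequality for the exponent \<open>p / q\<close> and the functions \<open>|f'|\<^sup>q\<close>. The factor 2 comes from
  the points of the half disk that are closest to the circle, at distance at least \<open>d / 2\<close>.
\<close>

lemma derivative_controls_mean:
  assumes f: "f holomorphic_on ball 0 1" and p: "1 \<le> p" and q: "0 < q" "ennreal q \<le> p" and w: "majorant \<omega>"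
    and M: "0 < M" "\<And>z. z \<in> ball 0 1 \<Longrightarrow> rot_bound p (\<lambda>\<eta>. cmod (deriv f (z * cis \<eta>))) (M * (\<omega> (disk_dist z) / disk_dist z))"
    and z: "z \<in> ball 0 1"
  shows "rot_bound p (\<lambda>\<eta>. deriv_mean f q z \<eta> powr (1 / q)) (2 * M * (\<omega> (disk_dist z) / disk_dist z))"
proof -
  note w' = majorantD[OF w]
  define D where "D z = cmod (indicator (ball 0 1) z *\<^sub>R deriv f z)" for z
  have D [measurable]: "D \<in> borel_measurable borel"
    unfolding D_def by (rule borel_measurable_indicator_deriv[OF f])
  define d where "d = disk_dist z"
  have d: "0 < d" using z by (simp add: d_def disk_dist_def)
  define K where "K = 2 * M * (\<omega> d / d)"
  have K: "0 \<le> K" using M d w'(3)[of d] by (simp add: K_def)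
  define V where "V = pi * (d / 2)\<^sup>2"
  have V: "0 < V" "emeasure lborel (half_disk z) = ennreal V"
    using emeasure_half_disk[OF z] by (simp_all add: V_def d_def)
  have inD: "\<xi> \<in> ball 0 1 \<and> D (\<xi> * cis \<eta>) = cmod (deriv f (\<xi> * cis \<eta>))" if "\<xi> \<in> half_disk z" for \<xi> \<eta>
  proof -
    have "\<xi> \<in> ball 0 1" by (rule half_disk_in_disk[OF z that])
    then show ?thesis by (simp add: D_def indicator_def norm_mult)
  qed
  have m0: "0 \<le> deriv_mean f q z \<eta>" for \<eta> by (simp add: deriv_mean_def)
  have pq: "1 \<le> p / ennreal q"
    using q by (cases p rule: ennreal_cases) (auto simp: divide_ennreal ennreal_top_divide ennreal_le_iff simp flip: ennreal_1)
  have p0: "0 < p" using p by (rule less_le_trans[rotated]) simp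
  have "rot_bound (p / ennreal q) (deriv_mean f q z) (K powr q)"
  proof (rule rot_bound_set_Minkowski[where A = "half_disk z" and h = "\<lambda>\<xi> \<eta>. 1 / V * D (\<xi> * cis \<eta>) powr q" and k = "\<lambda>_. 1 / V * K powr q"])
    show "(\<lambda>(\<xi>, \<eta>). 1 / V * D (\<xi> * cis \<eta>) powr q) \<in> borel_measurable (borel \<Otimes>\<^sub>M borel)" by measurable
    show "(\<integral>\<^sup>+\<xi>\<in>half_disk z. ennreal (1 / V * K powr q) \<partial>lborel) \<le> ennreal (K powr q)"
      using V by (subst nn_integral_cmult_indicator) (simp_all add: half_disk_def flip: ennreal_mult)
    fix \<xi> assume \<xi>: "\<xi> \<in> half_disk z"
    have "dist z \<xi> < d / 2" using \<xi> by (simp add: half_disk_def d_def)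
    then have d\<xi>: "d / 2 \<le> disk_dist \<xi>"
      using norm_triangle_ineq2[of \<xi> z] by (simp add: disk_dist_def d_def dist_norm norm_minus_commute field_simps)
    have "M * (\<omega> (disk_dist \<xi>) / disk_dist \<xi>) \<le> M * (\<omega> (d / 2) / (d / 2))"
      using M d d\<xi> by (intro growth_mono[OF w]) auto
    also have "\<dots> \<le> M * (\<omega> d / (d / 2))"
      using M d by (intro mult_left_mono divide_right_mono w'(2)) auto
    also have "\<dots> = K" using d by (simp add: K_def)
    finally have le: "M * (\<omega> (disk_dist \<xi>) / disk_dist \<xi>) \<le> K" .
    have "(\<lambda>\<eta>. D (\<xi> * cis \<eta>)) = (\<lambda>\<eta>. cmod (deriv f (\<xi> * cis \<eta>)))" using inD[OF \<xi>] by auto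
    then have b: "rot_bound p (\<lambda>\<eta>. D (\<xi> * cis \<eta>)) K"
      using M(1) d d\<xi> w'(3)[of "disk_dist \<xi>"] le half_disk_in_disk[OF z \<xi>]
      by (simp only:) (intro rot_bound_mono[OF M(2)[of \<xi>]], auto)
    then have "rot_bound (p / ennreal q) (\<lambda>\<eta>. D (\<xi> * cis \<eta>) powr q) (K powr q)"
      using q p0 K by (subst rot_bound_powr_iff) (auto simp: D_def)
    then show "rot_bound (p / ennreal q) (\<lambda>\<eta>. 1 / V * D (\<xi> * cis \<eta>) powr q) (1 / V * K powr q)"
      using V by (intro rot_bound_scale) auto
  next
    fix \<eta> :: real
    have "ennreal (deriv_mean f q z \<eta>) = (\<integral>\<^sup>+\<xi>\<in>half_disk z. ennreal (cmod (deriv f (\<xi> * cis \<eta>)) powr q) \<partial>lborel) / ennreal V"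
      using deriv_mean_eq[OF f q(1) z, of \<eta>] V by simp
    also have "\<dots> = (\<integral>\<^sup>+\<xi>. ennreal (D (\<xi> * cis \<eta>) powr q) * indicator (half_disk z) \<xi> \<partial>lborel) * ennreal (1 / V)"
    proof -
      have "(\<integral>\<^sup>+\<xi>\<in>half_disk z. ennreal (cmod (deriv f (\<xi> * cis \<eta>)) powr q) \<partial>lborel)
          = (\<integral>\<^sup>+\<xi>. ennreal (D (\<xi> * cis \<eta>) powr q) * indicator (half_disk z) \<xi> \<partial>lborel)"
        using inD by (intro nn_integral_cong) (simp add: indicator_def)
      then show ?thesis using V by (simp add: divide_ennreal_def inverse_ennreal divide_inverse)
    qed
    also have "\<dots> = (\<integral>\<^sup>+\<xi>. ennreal (D (\<xi> * cis \<eta>) powr q) * indicator (half_disk z) \<xi> * ennreal (1 / V) \<partial>lborel)"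
    proof (rule nn_integral_multc[symmetric])
      have [measurable]: "half_disk z \<in> sets borel" by (simp add: half_disk_def)
      show "(\<lambda>\<xi>. ennreal (D (\<xi> * cis \<eta>) powr q) * indicator (half_disk z) \<xi>) \<in> borel_measurable lborel"
        by measurable
    qed
    also have "\<dots> = (\<integral>\<^sup>+\<xi>\<in>half_disk z. ennreal (1 / V * D (\<xi> * cis \<eta>) powr q) \<partial>lborel)"
    proof (intro nn_integral_cong)
      fix \<xi>
      have "ennreal (D (\<xi> * cis \<eta>) powr q) * ennreal (1 / V) = ennreal (1 / V * D (\<xi> * cis \<eta>) powr q)"
        using V by (subst ennreal_mult[symmetric]) (auto simp: mult.commute)
      then show "ennreal (D (\<xi> * cis \<eta>) powr q) * indicator (half_disk z) \<xi> * ennreal (1 / V)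
        = ennreal (1 / V * D (\<xi> * cis \<eta>) powr q) * indicator (half_disk z) \<xi>"
        by (cases "\<xi> \<in> half_disk z") auto
    qed
    finally show "ennreal (deriv_mean f q z \<eta>) \<le> (\<integral>\<^sup>+\<xi>\<in>half_disk z. ennreal (1 / V * D (\<xi> * cis \<eta>) powr q) \<partial>lborel)" by simp
  qed (use pq V K m0 in \<open>auto simp: half_disk_def D_def\<close>)
  then have "rot_bound (p / ennreal q) (\<lambda>\<eta>. (deriv_mean f q z \<eta> powr (1 / q)) powr q) (K powr q)"
    using q m0 by (simp add: powr_powr)
  then show ?thesis
    using q p0 K by (subst (asm) rot_bound_powr_iff) (auto simp: K_def d_def)
qed

lemma mean_controls_derivative:
  assumes f: "f holomorphic_on ball 0 1" and q: "0 < q"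
  obtains C where "0 < C" "\<And>z \<eta>. z \<in> ball 0 1 \<Longrightarrow> cmod (deriv f (z * cis \<eta>)) \<le> C * deriv_mean f q z \<eta> powr (1 / q)"
proof -
  obtain C where C: "0 < C" "\<And>G z r. 0 < r \<Longrightarrow> continuous_on (cball z r) G \<Longrightarrow> G holomorphic_on ball z r \<Longrightarrow>
    ennreal (pi * r\<^sup>2 * cmod (G z) powr q) \<le> ennreal C * (\<integral>\<^sup>+\<zeta>\<in>ball z r. ennreal (cmod (G \<zeta>) powr q) \<partial>lborel)"
    using power_submean[OF q] by blast
  show ?thesis
  proof (rule that[of "C powr (1 / q)"])
    show "0 < C powr (1 / q)" using C by simp
    fix z :: complex and \<eta> assume z: "z \<in> ball 0 1"
    define r where "r = disk_dist z / 2"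
    have r: "0 < r" using z by (simp add: r_def disk_dist_def)
    define V where "V = pi * r\<^sup>2"
    have V: "0 < V" "emeasure lborel (half_disk z) = ennreal V"
      using emeasure_half_disk[OF z] by (simp_all add: V_def r_def)
    define G where "G \<xi> = deriv f (\<xi> * cis \<eta>)" for \<xi>
    have sub: "cball z r \<subseteq> ball 0 1" unfolding r_def by (rule half_disk_subset[OF z])
    have hol: "G holomorphic_on cball z r" unfolding G_def
      by (rule holomorphic_on_compose_gen[OF _ holomorphic_deriv[OF f open_ball], of "\<lambda>\<xi>. \<xi> * cis \<eta>", unfolded o_def])
         (use sub in \<open>auto intro!: holomorphic_intros simp: norm_mult subset_iff\<close>)
    have m0: "0 \<le> deriv_mean f q z \<eta>" by (simp add: deriv_mean_def)
    define I where "I = (\<integral>\<^sup>+\<xi>\<in>half_disk z. ennreal (cmod (G \<xi>) powr q) \<partial>lborel)"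
    have "I / ennreal V = ennreal (deriv_mean f q z \<eta>)"
      using deriv_mean_eq[OF f q z, of \<eta>] V by (simp add: I_def G_def)
    moreover have "I = (I / ennreal V) * ennreal V"
      using V by (simp add: ennreal_divide_times ennreal_eq_0_iff)
    ultimately have I: "I = ennreal (deriv_mean f q z \<eta> * V)"
      using V m0 by (simp add: ennreal_mult)
    have "ennreal (V * cmod (G z) powr q) \<le> ennreal C * I"
      unfolding V_def I_def half_disk_def r_def[symmetric]
      using hol holomorphic_on_subset[OF hol ball_subset_cball]
      by (intro C r holomorphic_on_imp_continuous_on) auto
    also have "\<dots> = ennreal (C * (deriv_mean f q z \<eta> * V))"
      unfolding I using C by (simp add: ennreal_mult')
    finally have "V * cmod (G z) powr q \<le> C * (deriv_mean f q z \<eta> * V)"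
      using C V m0 by (simp add: ennreal_le_iff)
    then have "cmod (G z) powr q \<le> C * deriv_mean f q z \<eta>" using V by (simp add: field_simps)
    then have "(cmod (G z) powr q) powr (1 / q) \<le> (C * deriv_mean f q z \<eta>) powr (1 / q)"
      using q by (intro powr_mono2) auto
    then show "cmod (deriv f (z * cis \<eta>)) \<le> C powr (1 / q) * deriv_mean f q z \<eta> powr (1 / q)"
      using q C m0 by (simp add: powr_powr powr_mult G_def)
  qed
qed

section \<open>The equivalences\<close>

text \<open>
  The constant that touches \<open>|f|\<close> at \<open>z\<close> is the conjugate of the sign of \<open>f z\<close>.
\<close>

lemma supported_by_cmod: "supported_by f (\<lambda>z. cmod (f z))"
  unfolding supported_by_def
proof
  fix z :: complex
  have le: "Re (c * f \<zeta>) \<le> cmod (f \<zeta>)" if "cmod c = 1" for c \<zeta>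
    using complex_Re_le_cmod[of "c * f \<zeta>"] that by (simp add: norm_mult del: times_complex.sel)
  obtain c where "cmod c = 1" "Re (c * f z) = cmod (f z)"
  proof (cases "f z = 0")
    case False
    have "cnj (sgn (f z)) * f z = of_real (cmod (f z))"
      using False by (simp add: sgn_eq complex_norm_square[symmetric] mult.commute[of "cnj _"] power2_eq_square)
    then show ?thesis using False by (intro that[of "cnj (sgn (f z))"]) (simp_all add: norm_sgn del: times_complex.sel)
  qed (use that[of 1] in simp)
  then show "\<exists>c. cmod c = 1 \<and> Re (c * f z) = cmod (f z) \<and> (\<forall>\<zeta>\<in>ball 0 1. Re (c * f \<zeta>) \<le> cmod (f \<zeta>))"
    using le by blast
qed

text \<open>
  With \<open>a = 1\<close> and \<open>a = -\<i>\<close> this covers the real and the imaginary part of \<open>f\<close>; for the absolute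
  value the constant changes its sign with that of \<open>g z\<close>.
\<close>

lemma supported_by_part:
  assumes a: "cmod a = 1" and g: "\<And>z. z \<in> cball 0 1 \<Longrightarrow> g z = Re (a * f z)"
  shows "supported_by f g" "supported_by f (\<lambda>z. \<bar>g z\<bar>)"
proof -
  have g': "g z = Re (a * f z)" if "z \<in> ball 0 1" for z using g that by (simp add: less_imp_le)
  show "supported_by f g" unfolding supported_by_def
    using a g' by (intro ballI exI[of _ a]) simp
  show "supported_by f (\<lambda>z. \<bar>g z\<bar>)" unfolding supported_by_def
  proof
    fix z :: complex assume z: "z \<in> ball 0 1"
    define c where "c = (if 0 \<le> g z then a else - a)"
    have "Re (c * f \<zeta>) = (if 0 \<le> g z then g \<zeta> else - g \<zeta>)" if "\<zeta> \<in> ball 0 1" for \<zeta>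
      using g'[OF that] by (simp add: c_def)
    then have "cmod c = 1 \<and> Re (c * f z) = \<bar>g z\<bar> \<and> (\<forall>\<zeta>\<in>ball 0 1. Re (c * f \<zeta>) \<le> \<bar>g \<zeta>\<bar>)"
      using a z by (auto simp: c_def simp del: times_complex.sel)
    then show "\<exists>c. cmod c = 1 \<and> Re (c * f z) = \<bar>g z\<bar> \<and> (\<forall>\<zeta>\<in>ball 0 1. Re (c * f \<zeta>) \<le> \<bar>g \<zeta>\<bar>)" by blast
  qed
qed

lemma part_contraction:
  assumes a: "cmod a = 1"
  shows "\<bar>Re (a * w1) - Re (a * w2)\<bar> \<le> cmod (w1 - w2)"
proof -
  have "\<bar>Re (a * w1) - Re (a * w2)\<bar> = \<bar>Re (a * (w1 - w2))\<bar>" by (simp add: algebra_simps)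
  also have "\<dots> \<le> cmod (a * (w1 - w2))" by (rule abs_Re_le_cmod)
  finally show ?thesis using a by (simp add: norm_mult)
qed

lemma majorant_quotient_nonneg:
  assumes "majorant \<omega>" "z \<in> ball 0 1"
  shows "0 \<le> \<omega> (disk_dist z) / disk_dist z"
  using majorantD(3)[OF assms(1), of "disk_dist z"] assms(2) by (simp add: disk_dist_def)

lemma circle_mean_growth_iff:
  assumes p: "1 \<le> p" and w: "majorant \<omega>"
  shows "majorant_growth \<omega> (circle_mean p F) \<longleftrightarrow>
    (\<exists>M>0. \<forall>z\<in>ball 0 1. rot_bound p (\<lambda>\<eta>. cmod (F (z * cis \<eta>))) (M * (\<omega> (disk_dist z) / disk_dist z)))"
  unfolding majorant_growth_def
  using majorant_quotient_nonneg[OF w]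
  by (intro ex_cong1 conj_cong refl ball_cong circle_mean_le_iff[OF p] mult_nonneg_nonneg) auto

lemma Lip_class_iff:
  assumes p: "1 \<le> p" and w: "majorant \<omega>" and F: "continuous_on (cball 0 1) F"
  shows "F \<in> Lip_class \<omega> p \<longleftrightarrow>
    (\<exists>M>0. \<forall>z1\<in>cball 0 1. \<forall>z2\<in>cball 0 1.
       rot_bound p (\<lambda>\<eta>. cmod (F (cis \<eta> * z1) - F (cis \<eta> * z2))) (M * \<omega> (cmod (z1 - z2))))"
proof -
  have "F \<in> borel_measurable (restrict_space borel (cball 0 1))"
    using F by (rule borel_measurable_continuous_on_restrict)
  then have "F \<in> Lip_class \<omega> p \<longleftrightarrow> (\<exists>M>0. \<forall>z1\<in>cball 0 1. \<forall>z2\<in>cball 0 1.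
        Lp_diff p F z1 z2 \<le> ennreal (M * \<omega> (cmod (z1 - z2))))"
    by (simp add: Lip_class_def)
  also have "\<dots> \<longleftrightarrow> (\<exists>M>0. \<forall>z1\<in>cball 0 1. \<forall>z2\<in>cball 0 1.
       rot_bound p (\<lambda>\<eta>. cmod (F (cis \<eta> * z1) - F (cis \<eta> * z2))) (M * \<omega> (cmod (z1 - z2))))"
    using majorantD(3)[OF w]
    by (intro ex_cong1 conj_cong refl ball_cong Lp_diff_le_iff[OF p] mult_nonneg_nonneg) auto
  finally show ?thesis .
qed

lemma derivative_growth_imp_Lip_class:
  assumes f: "f \<in> disk_algebra" and p: "1 \<le> p" and w: "fast_majorant \<omega>"
    and growth: "majorant_growth \<omega> (circle_mean p (deriv f))"
  shows "f \<in> Lip_class \<omega> p"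
proof -
  have maj: "majorant \<omega>" using w by (simp add: fast_majorant_def)
  obtain M where M: "0 < M" "\<And>z. z \<in> ball 0 1 \<Longrightarrow>
      rot_bound p (\<lambda>\<eta>. cmod (deriv f (z * cis \<eta>))) (M * (\<omega> (disk_dist z) / disk_dist z))"
    using growth unfolding circle_mean_growth_iff[OF p maj] by blast
  have contf: "continuous_on (cball 0 1) f" using f by (simp add: disk_algebra_def)
  show ?thesis
  proof (rule Hardy_Littlewood_closed_disk[OF f p w M])
    fix M' assume "0 < M'" "\<And>z1 z2. z1 \<in> cball 0 1 \<Longrightarrow> z2 \<in> cball 0 1 \<Longrightarrow>
      rot_bound p (\<lambda>\<eta>. cmod (f (cis \<eta> * z1) - f (cis \<eta> * z2))) (M' * \<omega> (cmod (z1 - z2)))"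
    then show ?thesis unfolding Lip_class_iff[OF p maj contf] by blast
  qed
qed

lemma Lip_class_contraction:
  assumes p: "1 \<le> p" and w: "majorant \<omega>" and f: "f \<in> Lip_class \<omega> p" "continuous_on (cball 0 1) f"
    and g: "continuous_on (cball 0 1) g"
    and contr: "\<And>z1 z2. z1 \<in> cball 0 1 \<Longrightarrow> z2 \<in> cball 0 1 \<Longrightarrow> cmod (g z1 - g z2) \<le> cmod (f z1 - f z2)"
  shows "g \<in> Lip_class \<omega> p"
proof -
  obtain M where M: "M > 0" "\<And>z1 z2. z1 \<in> cball 0 1 \<Longrightarrow> z2 \<in> cball 0 1 \<Longrightarrow>
       rot_bound p (\<lambda>\<eta>. cmod (f (cis \<eta> * z1) - f (cis \<eta> * z2))) (M * \<omega> (cmod (z1 - z2)))"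
    using f unfolding Lip_class_iff[OF p w f(2)] by blast
  have "rot_bound p (\<lambda>\<eta>. cmod (g (cis \<eta> * z1) - g (cis \<eta> * z2))) (M * \<omega> (cmod (z1 - z2)))"
    if "z1 \<in> cball 0 1" "z2 \<in> cball 0 1" for z1 z2
    using that M(1) majorantD(3)[OF w, of "cmod (z1 - z2)"]
    by (intro rot_bound_mono[OF M(2)[OF that]] contr) (auto simp: norm_mult)
  then show ?thesis unfolding Lip_class_iff[OF p w g] using M(1) by blast
qed

lemma Lip_class_imp_derivative_growth:
  fixes g :: "complex \<Rightarrow> real"
  assumes f: "f \<in> disk_algebra" and p: "1 \<le> p" and w: "majorant \<omega>"
    and g: "continuous_on (cball 0 1) g" "supported_by f g" "(\<lambda>z. complex_of_real (g z)) \<in> Lip_class \<omega> p"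
  shows "majorant_growth \<omega> (circle_mean p (deriv f))"
proof -
  have cg: "continuous_on (cball 0 1) (\<lambda>z. complex_of_real (g z))" by (intro continuous_intros g)
  obtain M where M: "M > 0" "\<And>z1 z2. z1 \<in> cball 0 1 \<Longrightarrow> z2 \<in> cball 0 1 \<Longrightarrow>
       rot_bound p (\<lambda>\<eta>. cmod (complex_of_real (g (cis \<eta> * z1)) - complex_of_real (g (cis \<eta> * z2)))) (M * \<omega> (cmod (z1 - z2)))"
    using g(3) unfolding Lip_class_iff[OF p w cg] by blast
  have "rot_bound p (\<lambda>\<eta>. cmod (deriv f (z * cis \<eta>))) (8 * M * (\<omega> (disk_dist z) / disk_dist z))"
    if "z \<in> ball 0 1" for z
    using M(2) by (intro oscillation_controls_derivative[OF f p w g(1,2) M(1) _ that]) (simp flip: of_real_diff)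
  then show ?thesis unfolding circle_mean_growth_iff[OF p w] using M(1) by (intro exI[of _ "8 * M"]) simp
qed

lemma derivative_growth_iff_Lip_class:
  fixes g :: "complex \<Rightarrow> real"
  assumes f: "f \<in> disk_algebra" and p: "1 \<le> p" and w: "fast_majorant \<omega>"
    and g: "continuous_on (cball 0 1) g" "supported_by f g"
    and contr: "\<And>z1 z2. z1 \<in> cball 0 1 \<Longrightarrow> z2 \<in> cball 0 1 \<Longrightarrow> \<bar>g z1 - g z2\<bar> \<le> cmod (f z1 - f z2)"
  shows "majorant_growth \<omega> (circle_mean p (deriv f)) \<longleftrightarrow> (\<lambda>z. complex_of_real (g z)) \<in> Lip_class \<omega> p"
proof
  have maj: "majorant \<omega>" using w by (simp add: fast_majorant_def)
  show "majorant_growth \<omega> (circle_mean p (deriv f))" if "(\<lambda>z. complex_of_real (g z)) \<in> Lip_class \<omega> p"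
    by (rule Lip_class_imp_derivative_growth[OF f p maj g that])
  assume growth: "majorant_growth \<omega> (circle_mean p (deriv f))"
  show "(\<lambda>z. complex_of_real (g z)) \<in> Lip_class \<omega> p"
  proof (rule Lip_class_contraction[OF p maj derivative_growth_imp_Lip_class[OF f p w growth]])
    show "continuous_on (cball 0 1) (\<lambda>z. complex_of_real (g z))" by (intro continuous_intros g)
  qed (use f contr in \<open>auto simp: disk_algebra_def simp flip: of_real_diff\<close>)
qed

lemma derivative_growth_iff_dilation_growth:
  assumes f: "f holomorphic_on ball 0 1" and u: "\<And>\<zeta>. \<zeta> \<in> ball 0 1 \<Longrightarrow> u \<zeta> = Re (f \<zeta>)"
    and p: "1 \<le> p" and w: "majorant \<omega>" and q: "0 < q" "ennreal q \<le> p"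
  shows "majorant_growth \<omega> (circle_mean p (deriv f)) \<longleftrightarrow> majorant_growth \<omega> (dilation_mean u q p)"
proof -
  have dil: "majorant_growth \<omega> (dilation_mean u q p) \<longleftrightarrow>
    (\<exists>M>0. \<forall>z\<in>ball 0 1. rot_bound p (\<lambda>\<eta>. deriv_mean f q z \<eta> powr (1 / q)) (M * (\<omega> (disk_dist z) / disk_dist z)))"
    unfolding majorant_growth_def using majorant_quotient_nonneg[OF w]
    by (intro ex_cong1 conj_cong refl ball_cong dilation_mean_le_iff[OF f u _ p q(1)] mult_nonneg_nonneg) auto
  show ?thesis unfolding dil circle_mean_growth_iff[OF p w]
  proof (intro iffI; elim exE conjE)
    fix M assume M: "0 < M" "\<forall>z\<in>ball 0 1. rot_bound p (\<lambda>\<eta>. cmod (deriv f (z * cis \<eta>))) (M * (\<omega> (disk_dist z) / disk_dist z))"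
    then have "rot_bound p (\<lambda>\<eta>. deriv_mean f q z \<eta> powr (1 / q)) (2 * M * (\<omega> (disk_dist z) / disk_dist z))"
      if "z \<in> ball 0 1" for z
      using that by (intro derivative_controls_mean[OF f p q w]) auto
    then show "\<exists>M>0. \<forall>z\<in>ball 0 1. rot_bound p (\<lambda>\<eta>. deriv_mean f q z \<eta> powr (1 / q)) (M * (\<omega> (disk_dist z) / disk_dist z))"
      using M(1) by (intro exI[of _ "2 * M"]) simp
  next
    fix M assume M: "0 < M" "\<forall>z\<in>ball 0 1. rot_bound p (\<lambda>\<eta>. deriv_mean f q z \<eta> powr (1 / q)) (M * (\<omega> (disk_dist z) / disk_dist z))"
    obtain C where C: "0 < C" "\<And>z \<eta>. z \<in> ball 0 1 \<Longrightarrow> cmod (deriv f (z * cis \<eta>)) \<le> C * deriv_mean f q z \<eta> powr (1 / q)"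
      using mean_controls_derivative[OF f q(1)] by blast
    have "rot_bound p (\<lambda>\<eta>. cmod (deriv f (z * cis \<eta>))) (C * M * (\<omega> (disk_dist z) / disk_dist z))" if z: "z \<in> ball 0 1" for z
    proof (rule rot_bound_mono)
      have [measurable]: "deriv_mean f q z \<in> borel_measurable borel" by (rule measurable_deriv_mean[OF f z])
      show "rot_bound p (\<lambda>\<eta>. C * deriv_mean f q z \<eta> powr (1 / q)) (C * (M * (\<omega> (disk_dist z) / disk_dist z)))"
        using M C(1) z majorant_quotient_nonneg[OF w z] by (intro rot_bound_scale mult_nonneg_nonneg) auto
      show "0 \<le> C * (M * (\<omega> (disk_dist z) / disk_dist z))"
        using M C(1) majorant_quotient_nonneg[OF w z] by (intro mult_nonneg_nonneg) auto
    qed (use C(2)[OF z] in \<open>simp_all add: mult.assoc\<close>)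
    then show "\<exists>M>0. \<forall>z\<in>ball 0 1. rot_bound p (\<lambda>\<eta>. cmod (deriv f (z * cis \<eta>))) (M * (\<omega> (disk_dist z) / disk_dist z))"
      using M(1) C(1) by (intro exI[of _ "C * M"]) simp
  qed
qed

text \<open>
  Reduces statements on the imaginary part of \<open>f\<close> to the real part of \<open>-\<i> f\<close>.
\<close>

lemma circle_mean_deriv_unimodular:
  assumes f: "f holomorphic_on ball 0 1" and a: "cmod a = 1" and p: "1 \<le> p" and w: "majorant \<omega>"
  shows "majorant_growth \<omega> (circle_mean p (deriv (\<lambda>z. a * f z))) \<longleftrightarrow> majorant_growth \<omega> (circle_mean p (deriv f))"
proof -
  have "cmod (deriv (\<lambda>z. a * f z) (z * cis \<eta>)) = cmod (deriv f (z * cis \<eta>))" if "z \<in> ball 0 1" for z \<eta>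
  proof -
    have "z * cis \<eta> \<in> ball 0 1" using that by (simp add: norm_mult)
    then have "f field_differentiable at (z * cis \<eta>)"
      using f holomorphic_on_imp_differentiable_at open_ball by blast
    then show ?thesis using a by (simp add: norm_mult)
  qed
  then show ?thesis unfolding circle_mean_growth_iff[OF p w] by simp
qed

theorem corollary2p4:
  fixes p :: ennreal and q :: real and \<omega> :: "real \<Rightarrow> real"
    and f :: "complex \<Rightarrow> complex" and u v :: "complex \<Rightarrow> real"
  assumes "1 \<le> p"
    and "fast_majorant \<omega>"
    and "f \<in> disk_algebra"
    and "\<And>z. z \<in> ball 0 1 \<Longrightarrow> f z = complex_of_real (u z) + \<i> * complex_of_real (v z)"
    and "continuous_on (cball 0 1) u" and "continuous_on (cball 0 1) v"
    and "0 < q" and "ennreal q \<le> p"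
  shows "let B1 = majorant_growth \<omega> (circle_mean p (deriv f));
             B2 = f \<in> Lip_class \<omega> p;
             B3 = (\<lambda>z. complex_of_real (cmod (f z))) \<in> Lip_class \<omega> p;
             B4 = (\<lambda>z. complex_of_real (u z)) \<in> Lip_class \<omega> p;
             B5 = (\<lambda>z. complex_of_real \<bar>u z\<bar>) \<in> Lip_class \<omega> p;
             B6 = (\<lambda>z. complex_of_real (v z)) \<in> Lip_class \<omega> p;
             B7 = (\<lambda>z. complex_of_real \<bar>v z\<bar>) \<in> Lip_class \<omega> p;
             B8 = majorant_growth \<omega> (dilation_mean u q p);
             B9 = majorant_growth \<omega> (dilation_mean v q p)
         in (B1 \<longleftrightarrow> B2) \<and> (B1 \<longleftrightarrow> B3) \<and> (B1 \<longleftrightarrow> B4) \<and> (B1 \<longleftrightarrow> B5) \<and>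
            (B1 \<longleftrightarrow> B6) \<and> (B1 \<longleftrightarrow> B7) \<and> (B1 \<longleftrightarrow> B8) \<and> (B1 \<longleftrightarrow> B9)"
proof -
  note p = assms(1) and w = assms(2) and f = assms(3) and q = assms(7,8)
  have maj: "majorant \<omega>" using w by (simp add: fast_majorant_def)
  have holf: "f holomorphic_on ball 0 1" and contf: "continuous_on (cball 0 1) f"
    using f by (auto simp: disk_algebra_def)
  have f_eq: "f z = complex_of_real (u z) + \<i> * complex_of_real (v z)" if "z \<in> cball 0 1" for z
  proof -
    define h where "h z = f z - (complex_of_real (u z) + \<i> * complex_of_real (v z))" for z
    have "continuous_on (closure (ball 0 1)) h"
      unfolding h_def using contf assms(5,6) by (auto intro!: continuous_intros)
    moreover have "z \<in> closure (ball 0 1)" using that by simp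
    moreover have "\<And>z. z \<in> ball 0 1 \<Longrightarrow> h z = 0" using assms(4) by (simp add: h_def)
    ultimately have "h z = 0" using continuous_constant_on_closure[of "ball 0 1" h 0 z] by blast
    then show ?thesis by (simp add: h_def)
  qed
  have u: "u z = Re (1 * f z)" and v: "v z = Re (- \<i> * f z)" if "z \<in> cball 0 1" for z
    using f_eq[OF that] by auto
  have one: "cmod 1 = 1" and mi: "cmod (- \<i>) = 1" by simp_all
  let ?B1 = "majorant_growth \<omega> (circle_mean p (deriv f))"
  have B4: "?B1 \<longleftrightarrow> (\<lambda>z. complex_of_real (u z)) \<in> Lip_class \<omega> p"
    using part_contraction[OF one] u
    by (intro derivative_growth_iff_Lip_class[OF f p w assms(5) supported_by_part(1)[OF one u]]) auto
  have B6: "?B1 \<longleftrightarrow> (\<lambda>z. complex_of_real (v z)) \<in> Lip_class \<omega> p"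
    using part_contraction[OF mi] v
    by (intro derivative_growth_iff_Lip_class[OF f p w assms(6) supported_by_part(1)[OF mi v]]) auto
  have cu: "continuous_on (cball 0 1) (\<lambda>z. \<bar>u z\<bar>)" and cv: "continuous_on (cball 0 1) (\<lambda>z. \<bar>v z\<bar>)"
    using assms(5,6) by (auto intro: continuous_intros)
  have B5: "?B1 \<longleftrightarrow> (\<lambda>z. complex_of_real \<bar>u z\<bar>) \<in> Lip_class \<omega> p"
  proof (rule derivative_growth_iff_Lip_class[OF f p w cu supported_by_part(2)[OF one u]])
    show "\<bar>\<bar>u z1\<bar> - \<bar>u z2\<bar>\<bar> \<le> cmod (f z1 - f z2)" if "z1 \<in> cball 0 1" "z2 \<in> cball 0 1" for z1 z2
      using part_contraction[OF one, of "f z1" "f z2"] abs_triangle_ineq3[of "u z1" "u z2"] unfolding u[OF that(1)] u[OF that(2)] by linarith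
  qed
  have B7: "?B1 \<longleftrightarrow> (\<lambda>z. complex_of_real \<bar>v z\<bar>) \<in> Lip_class \<omega> p"
  proof (rule derivative_growth_iff_Lip_class[OF f p w cv supported_by_part(2)[OF mi v]])
    show "\<bar>\<bar>v z1\<bar> - \<bar>v z2\<bar>\<bar> \<le> cmod (f z1 - f z2)" if "z1 \<in> cball 0 1" "z2 \<in> cball 0 1" for z1 z2
      using part_contraction[OF mi, of "f z1" "f z2"] abs_triangle_ineq3[of "v z1" "v z2"] unfolding v[OF that(1)] v[OF that(2)] by linarith
  qed
  have B3: "?B1 \<longleftrightarrow> (\<lambda>z. complex_of_real (cmod (f z))) \<in> Lip_class \<omega> p"
    by (rule derivative_growth_iff_Lip_class[OF f p w _ supported_by_cmod])
       (auto intro!: continuous_intros contf norm_triangle_ineq3)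
  have B2: "?B1 \<longleftrightarrow> f \<in> Lip_class \<omega> p"
  proof
    show "f \<in> Lip_class \<omega> p" if ?B1 by (rule derivative_growth_imp_Lip_class[OF f p w that])
    assume "f \<in> Lip_class \<omega> p"
    then have "(\<lambda>z. complex_of_real (cmod (f z))) \<in> Lip_class \<omega> p"
      by (rule Lip_class_contraction[OF p maj _ contf])
         (auto intro!: continuous_intros contf norm_triangle_ineq3 simp flip: of_real_diff)
    then show ?B1 using B3 by simp
  qed
  have B8: "?B1 \<longleftrightarrow> majorant_growth \<omega> (dilation_mean u q p)"
    using u by (intro derivative_growth_iff_dilation_growth[OF holf _ p maj q]) (simp add: less_imp_le)
  have "(\<lambda>z. - \<i> * f z) holomorphic_on ball 0 1" by (intro holomorphic_intros holf)
  then have "majorant_growth \<omega> (circle_mean p (deriv (\<lambda>z. - \<i> * f z))) \<longleftrightarrow> majorant_growth \<omega> (dilation_mean v q p)"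
    using v by (intro derivative_growth_iff_dilation_growth[OF _ _ p maj q]) (simp_all add: less_imp_le)
  then have B9: "?B1 \<longleftrightarrow> majorant_growth \<omega> (dilation_mean v q p)"
    unfolding circle_mean_deriv_unimodular[OF holf mi p maj] .
  show ?thesis unfolding Let_def using B2 B3 B4 B5 B6 B7 B8 B9 by blast
qed

end
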